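(* Suppose $A, B\in M_n$ are non-scalar normal matrices with $\sigma(A) = \{a_1, a_2\}$ and $\sigma(B) = \{b_1, b_2\}$. Let $S = \sigma(AB) \cap \{a_1b_1, a_1b_2, a_2b_1, a_2b_2\}$. Then $$W(AB) = \mathrm{conv}\Big\{\bigcup_{\lambda \in \sigma(AB)\setminus S} \mathcal{E}\big(a_1,a_2,b_1,b_2;\ \lambda+ (a_1a_2b_1b_2)/\lambda\big) \ \cup\ S\Big\}.$$
   Context: $M_n$ is the algebra of $n\times n$ complex matrices; $\sigma(X)$ is the spectrum, $W(X)=\{\langle Xx,x\rangle:\|x\|=1\}$ the numerical range, $\mathrm{conv}$ the convex hull; non-scalar means not a scalar multiple of the identity (so $a_1\ne a_2$ and $b_1\neq b_2$). For $a_1\ne a_2$, $b_1\ne b_2$ in $\mathbb{C}$ and $\gamma$ in the interior of the line segment with (distinct) end points $a_1b_1+a_2b_2$ and $a_1b_2+a_2b_1$, there is a unique $c\in(0,1)$, with $s=\sqrt{1-c^2}$, such that $\gamma=(a_1b_1+a_2b_2)c^2+(a_1b_2+a_2b_1)s^2$. One then defines $\mathcal{E}(a_1,a_2,b_1,b_2;\gamma)=W(C)$, an elliptical disk, where $$C=\begin{pmatrix} a_1c^2+a_2s^2 & (a_1-a_2)cs\\ (a_1-a_2)cs & a_1s^2+a_2c^2\end{pmatrix}\begin{pmatrix} b_1&0\\0&b_2\end{pmatrix},\qquad \mathrm{tr}\,C=\gamma.$$ For every $\lambda\in\sigma(AB)\setminus S$ one has $\lambda\neq0$ and $\lambda+a_1a_2b_1b_2/\lambda$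 lies in the interior of that segment.
   Formalization: Adds the hypothesis ker((AB)^2) = ker(AB), i.e. 0 is not a defective eigenvalue of AB; without it the formula fails, e.g. A = [[1,1],[1,1]], B = diag(1,-1), where AB is nonzero nilpotent and the right side is {0}. *)

theory Defs
  imports
    "Jordan_Normal_Form.Spectral_Radius"
    "Jordan_Normal_Form.Schur_Decomposition"
    "Jordan_Normal_Form.Matrix_Kernel"
    "HOL-Analysis.Line_Segment"
begin

definition normal_mat :: "complex mat \<Rightarrow> bool" where
  "normal_mat A \<longleftrightarrow> square_mat A \<and> A * mat_adjoint A = mat_adjoint A * A"

definition scalar_mat :: "complex mat \<Rightarrow> bool" where
  "scalar_mat A \<longleftrightarrow> (\<exists>k. A = k \<cdot>\<^sub>m 1\<^sub>m (dim_row A))"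

(* The inner product is linear in its first argument: v \<bullet>c w = v \<bullet> conjugate w. *)
definition numerical_range :: "complex mat \<Rightarrow> complex set" where
  "numerical_range X =
     {(X *\<^sub>v x) \<bullet>c x | x. x \<in> carrier_vec (dim_col X) \<and> x \<bullet>c x = 1}"

text \<open>For \<open>a1 \<noteq> a2\<close>, \<open>b1 \<noteq> b2\<close> and \<open>\<gamma>\<close> in the open segment between \<open>a1 * b1 + a2 * b2\<close> and
  \<open>a1 * b2 + a2 * b1\<close> the description below has exactly one solution (lemma
  \<open>ell_c_ex1\<close>); for other arguments the value is unspecified.\<close>

definition ell_c :: "complex \<Rightarrow> complex \<Rightarrow> complex \<Rightarrow> complex \<Rightarrow> complex \<Rightarrow> real" where
  "ell_c a1 a2 b1 b2 \<gamma> =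
     (THE c. 0 < c \<and> c < 1 \<and>
        \<gamma> = (a1 * b1 + a2 * b2) * complex_of_real (c\<^sup>2)
          + (a1 * b2 + a2 * b1) * complex_of_real ((sqrt (1 - c\<^sup>2))\<^sup>2))"

definition ell_C :: "complex \<Rightarrow> complex \<Rightarrow> complex \<Rightarrow> complex \<Rightarrow> complex \<Rightarrow> complex mat" where
  "ell_C a1 a2 b1 b2 \<gamma> =
     (let c = complex_of_real (ell_c a1 a2 b1 b2 \<gamma>);
          s = complex_of_real (sqrt (1 - (ell_c a1 a2 b1 b2 \<gamma>)\<^sup>2))
      in mat_of_rows_list 2
           [[a1 * c\<^sup>2 + a2 * s\<^sup>2, (a1 - a2) * c * s],
            [(a1 - a2) * c * s, a1 * s\<^sup>2 + a2 * c\<^sup>2]]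
         * mat_of_rows_list 2 [[b1, 0], [0, b2]])"

definition ell_disk :: "complex \<Rightarrow> complex \<Rightarrow> complex \<Rightarrow> complex \<Rightarrow> complex \<Rightarrow> complex set" where
  "ell_disk a1 a2 b1 b2 \<gamma> = numerical_range (ell_C a1 a2 b1 b2 \<gamma>)"

lemma ell_c_ex1:
  assumes "a1 \<noteq> a2" "b1 \<noteq> b2"
    and "\<gamma> \<in> open_segment (a1 * b1 + a2 * b2) (a1 * b2 + a2 * b1)"
  shows "\<exists>!c::real. 0 < c \<and> c < 1 \<and>
           \<gamma> = (a1 * b1 + a2 * b2) * complex_of_real (c\<^sup>2)
             + (a1 * b2 + a2 * b1) * complex_of_real ((sqrt (1 - c\<^sup>2))\<^sup>2)"
proof -
  let ?p = "a1 * b1 + a2 * b2" and ?q = "a1 * b2 + a2 * b1"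
  have "?p - ?q = (a1 - a2) * (b1 - b2)"
    by (simp add: algebra_simps)
  with assms(1,2) have pq: "?p - ?q \<noteq> 0"
    by simp
  obtain u where u: "0 < u" "u < 1" and g: "\<gamma> = (1 - u) *\<^sub>R ?p + u *\<^sub>R ?q"
    using assms(3) by (auto simp: in_segment)
  have s2: "(sqrt (1 - c\<^sup>2))\<^sup>2 = 1 - c\<^sup>2" if "0 < c" "c < 1" for c :: real
    using that by (simp add: power_le_one)
  show ?thesis
  proof (intro ex1I conjI)
    show "0 < sqrt (1 - u)" "sqrt (1 - u) < 1"
      using u by simp_all
    show "\<gamma> = ?p * complex_of_real ((sqrt (1 - u))\<^sup>2)
             + ?q * complex_of_real ((sqrt (1 - (sqrt (1 - u))\<^sup>2))\<^sup>2)"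
      using u by (simp add: g scaleR_conv_of_real algebra_simps)
  next
    fix c :: real
    assume c: "0 < c \<and> c < 1 \<and> \<gamma> = ?p * complex_of_real (c\<^sup>2)
             + ?q * complex_of_real ((sqrt (1 - c\<^sup>2))\<^sup>2)"
    then have "(sqrt (1 - c\<^sup>2))\<^sup>2 = 1 - c\<^sup>2"
      using s2 by blast
    with c have "\<gamma> = ?p * complex_of_real (c\<^sup>2) + ?q * complex_of_real (1 - c\<^sup>2)"
      by metis
    then have "(?p - ?q) * complex_of_real (c\<^sup>2) = (?p - ?q) * complex_of_real (1 - u)"
      unfolding g by (simp add: scaleR_conv_of_real algebra_simps)
    then have "complex_of_real (c\<^sup>2) = complex_of_real (1 - u)"
      using pq mult_left_cancel by blast
    then have "c\<^sup>2 = 1 - u"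
      by (simp only: of_real_eq_iff)
    then show "c = sqrt (1 - u)"
      using c by (metis real_sqrt_unique less_imp_le)
  qed
qed

lemma trace_ell_C:
  assumes "a1 \<noteq> a2" "b1 \<noteq> b2"
    and "\<gamma> \<in> open_segment (a1 * b1 + a2 * b2) (a1 * b2 + a2 * b1)"
  shows "ell_C a1 a2 b1 b2 \<gamma> $$ (0, 0) + ell_C a1 a2 b1 b2 \<gamma> $$ (1, 1) = \<gamma>"
proof -
  define c where "c = ell_c a1 a2 b1 b2 \<gamma>"
  define s where "s = sqrt (1 - c\<^sup>2)"
  have "\<gamma> = (a1 * b1 + a2 * b2) * complex_of_real (c\<^sup>2)
             + (a1 * b2 + a2 * b1) * complex_of_real (s\<^sup>2)"
    using theI'[OF ell_c_ex1[OF assms]] unfolding s_def c_def ell_c_def by blast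
  moreover have "ell_C a1 a2 b1 b2 \<gamma> $$ (0, 0) + ell_C a1 a2 b1 b2 \<gamma> $$ (1, 1)
      = (a1 * b1 + a2 * b2) * complex_of_real (c\<^sup>2)
             + (a1 * b2 + a2 * b1) * complex_of_real (s\<^sup>2)"
    unfolding ell_C_def Let_def c_def[symmetric] s_def[symmetric]
    by (simp add: mat_of_rows_list_def scalar_prod_def algebra_simps)
  ultimately show ?thesis
    by simp
qed

lemma spectrum_2x2:
  "spectrum (mat_of_rows_list 2 [[a, b], [c, d :: complex]]) =
     {k. (a - k) * (d - k) = b * c}" (is "spectrum ?M = _")
proof -
  have M: "?M \<in> carrier_mat 2 2"
    by (rule carrier_matI) (simp_all add: mat_of_rows_list_def)
  have "det (char_matrix ?M k) = (a - k) * (d - k) - b * c" for k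
  proof -
    define C where "C = char_matrix ?M k"
    have C: "C \<in> carrier_mat 2 2"
      using M by (simp add: C_def)
    have D: "mat_delete C i 0 \<in> carrier_mat 1 1" for i
      using C by (intro carrier_matI) (simp_all add: mat_delete_def)
    have entries: "C $$ (0, 0) = a - k" "C $$ (0, 1) = b" "C $$ (1, 0) = c" "C $$ (1, 1) = d - k"
      by (simp_all add: C_def char_matrix_def mat_of_rows_list_def)
    have minors: "mat_delete C 0 0 $$ (0, 0) = C $$ (1, 1)" "mat_delete C 1 0 $$ (0, 0) = C $$ (0, 1)"
      using C by (simp_all add: mat_delete_def)
    have two: "{..<2} = {0, 1::nat}"
      by auto
    have "det C = C $$ (0, 0) * C $$ (1, 1) - C $$ (1, 0) * C $$ (0, 1)"
      unfolding laplace_expansion_column[OF C zero_less_numeral] cofactor_def det_single[OF D] two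
      by (simp add: minors del: One_nat_def)
    then show ?thesis
      by (simp only: entries C_def[symmetric] mult.commute[of b c])
  qed
  then show ?thesis
    unfolding spectrum_def eigenvalue_det[OF M] by simp
qed

text \<open>If \<open>a1 * a2 * b1 * b2 = 0\<close> and \<open>0\<close> is in the open segment used above, then \<open>A * B\<close> can be
  unitarily similar to a matrix with a nonzero nilpotent 2-by-2 diagonal block. Such a block
  has the single eigenvalue \<open>0 \<in> S\<close>, so its disk does not occur on the right-hand side
  of the formula for the numerical range of \<open>A * B\<close>. The lemma below shows that the formula
  really fails then. The condition \<open>mat_kernel (A * B * (A * B)) = mat_kernel (A * B)\<close>, i.e.
  \<open>0\<close> is not a defective eigenvalue of \<open>A * B\<close>, excludes such blocks and nothing else; it
  holds automatically if \<open>a1\<close>, \<open>a2\<close>, \<open>b1\<close>, \<open>b2\<close> are nonzero.\<close>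

lemma formula_fails_without_kernel_condition:
  "\<exists>A B a1 a2 b1 b2 S. A \<in> carrier_mat 2 2 \<and> B \<in> carrier_mat 2 2 \<and>
     normal_mat A \<and> normal_mat B \<and> \<not> scalar_mat A \<and> \<not> scalar_mat B \<and>
     spectrum A = {a1, a2} \<and> spectrum B = {b1, b2} \<and>
     S = spectrum (A * B) \<inter> {a1 * b1, a1 * b2, a2 * b1, a2 * b2} \<and>
     numerical_range (A * B) \<noteq>
       convex hull
         ((\<Union>l \<in> spectrum (A * B) - S. ell_disk a1 a2 b1 b2 (l + (a1 * a2 * b1 * b2) / l)) \<union> S)"
proof -
  define A :: "complex mat" where "A = mat_of_rows_list 2 [[1, 1], [1, 1]]"
  define B :: "complex mat" where "B = mat_of_rows_list 2 [[1, 0], [0, - 1]]"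
  define S where "S = spectrum (A * B) \<inter> {0 * 1, 0 * - 1, 2 * 1, 2 * - (1::complex)}"
  have AB: "A * B = mat_of_rows_list 2 [[1, - 1], [1, - 1]]"
    by (rule eq_matI)
       (auto simp: A_def B_def mat_of_rows_list_def scalar_prod_def less_Suc_eq numeral_2_eq_2)
  have adj: "mat_adjoint A = A" "mat_adjoint B = B"
    by (rule eq_matI;
        auto simp: A_def B_def mat_of_rows_list_def mat_adjoint_def mat_of_rows_def less_Suc_eq numeral_2_eq_2)+
  have specA: "spectrum A = {0, 2}"
  proof -
    have "(1 - k) * (1 - k) = 1 * 1 \<longleftrightarrow> k * (k - 2) = 0" for k :: complex
      by (auto simp: algebra_simps)
    then show ?thesis
      unfolding A_def spectrum_2x2 by auto
  qed
  have specB: "spectrum B = {1, - 1}"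
    unfolding B_def spectrum_2x2 by (auto simp only: mult_eq_0_iff right_minus_eq mult_zero_left)
  have specAB: "spectrum (A * B) = {0}"
    unfolding AB spectrum_2x2 by (auto simp: algebra_simps)
  have "convex hull
      ((\<Union>l \<in> spectrum (A * B) - S. ell_disk 0 2 1 (- 1) (l + (0 * 2 * 1 * - 1) / l)) \<union> S) = {0}"
    by (simp add: S_def specAB)
  moreover have "1 \<in> numerical_range (A * B)"
  proof -
    define x :: "complex Matrix.vec" where "x = Matrix.vec 2 (\<lambda>i. if i = 0 then 1 else 0)"
    have x: "vec_index x 0 = 1" "vec_index x 1 = 0" "dim_vec x = 2"
      by (simp_all add: x_def)
    have two: "{0..<2} = {0, 1::nat}"
      by auto
    have "x \<in> carrier_vec (dim_col (A * B))"
      by (simp add: x_def AB mat_of_rows_list_def)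
    moreover have "x \<bullet>c x = 1"
      by (simp add: scalar_prod_def x two del: One_nat_def)
    moreover have "((A * B) *\<^sub>v x) \<bullet>c x = 1"
      unfolding AB by (simp add: mat_of_rows_list_def scalar_prod_def x two del: One_nat_def)
    ultimately show ?thesis
      unfolding numerical_range_def by (metis (mono_tags, lifting) mem_Collect_eq)
  qed
  ultimately have "numerical_range (A * B) \<noteq> convex hull
      ((\<Union>l \<in> spectrum (A * B) - S. ell_disk 0 2 1 (- 1) (l + (0 * 2 * 1 * - 1) / l)) \<union> S)"
    by (metis singletonD zero_neq_one)
  moreover have "A \<in> carrier_mat 2 2"
    by (rule carrier_matI) (simp_all add: A_def mat_of_rows_list_def)
  moreover have "B \<in> carrier_mat 2 2"
    by (rule carrier_matI) (simp_all add: B_def mat_of_rows_list_def)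
  moreover have "normal_mat A" "normal_mat B"
    unfolding normal_mat_def adj by (simp_all add: A_def B_def mat_of_rows_list_def)
  moreover have "\<not> scalar_mat A"
  proof
    assume "scalar_mat A"
    then obtain k where "A = k \<cdot>\<^sub>m 1\<^sub>m (dim_row A)"
      unfolding scalar_mat_def by blast
    then have "A $$ (0, 1) = (k \<cdot>\<^sub>m 1\<^sub>m (dim_row A)) $$ (0, 1)"
      by metis
    then show False
      by (simp add: A_def mat_of_rows_list_def)
  qed
  moreover have "\<not> scalar_mat B"
  proof
    assume "scalar_mat B"
    then obtain k where k: "B = k \<cdot>\<^sub>m 1\<^sub>m (dim_row B)"
      unfolding scalar_mat_def by blast
    have "B $$ (i, i) = (k \<cdot>\<^sub>m 1\<^sub>m (dim_row B)) $$ (i, i)" for i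
      using k by metis
    from this[of 0] this[of 1] show False
      by (simp add: B_def mat_of_rows_list_def)
  qed
  ultimately show ?thesis
    using specA specB S_def
    by (intro exI[of _ A] exI[of _ B] exI[of _ 0] exI[of _ 2] exI[of _ 1] exI[of _ "- 1"] exI[of _ S] conjI)
qed

end

theory Submission
  imports Defs
begin

text \<open>
A normal matrix with two eigenvalues is an affine function of an orthogonal projection, so
\<open>A = a2 + (a1 - a2) P\<close> and \<open>B = b2 + (b1 - b2) Q\<close>. The self-adjoint operator \<open>H = (P + Q - 1)\<^sup>2\<close>
commutes with \<open>P\<close> and \<open>Q\<close>. Its eigenspaces \<open>E t\<close>, with \<open>0 \<le> t \<le> 1\<close>, are therefore orthogonal,
span the whole space and are invariant under \<open>M = A B\<close>. For \<open>0 < t < 1\<close> the restriction of \<open>M\<close>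
to \<open>E t\<close> is an orthogonal sum of copies of the two-by-two matrix \<open>C\<close> with \<open>c\<^sup>2 = t\<close>, while on \<open>E 0\<close>
and \<open>E 1\<close> the projections commute and \<open>M\<close> is diagonal with entries \<open>a\<^sub>i b\<^sub>j\<close>. Since the numerical
range of an orthogonal sum is the convex hull of the numerical ranges of the summands, the
formula follows.

The copies of \<open>C\<close> inside \<open>E t\<close> are never separated. For \<open>x\<close> in \<open>E t\<close> with
parts \<open>y = Q x\<close> and \<open>z = x - Q x\<close>, the value of the form of \<open>M\<close> at \<open>x\<close> depends only on the squared
norms of \<open>y\<close> and \<open>z\<close> and on the cross term \<open>m = (P y) \<bullet>c z\<close> (\<open>form_M\<close>), and the modulus of \<open>m\<close>
is at most \<open>c s\<close> times the two norms (\<open>cross_bound\<close>). The points of the elliptical disk are those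
where equality holds, and a smaller \<open>m\<close> is the midpoint of two such extreme ones
(\<open>block_value_in_disk\<close>). Conversely, one vector of \<open>E t\<close> generates a single copy of \<open>C\<close>, so the disk
is contained in the numerical range (\<open>disk_subset_numerical_range\<close>), which is convex by the
Toeplitz--Hausdorff theorem.

It remains to match the disks with eigenvalues. The Cayley--Hamilton relations of the blocks
combine to one identity between \<open>M\<close> and \<open>H\<close> (\<open>quadratic_relation\<close>). It shows that an eigenvector
of \<open>M\<close> whose eigenvalue \<open>l\<close> is not a product \<open>a\<^sub>i b\<^sub>j\<close> lies in the space \<open>E t\<close> for which
\<open>l + a1 a2 b1 b2 / l\<close> is the trace of \<open>C\<close> (\<open>eigenvalue_block\<close>). In the other direction, every \<open>t\<close> in
the spectrum of \<open>H\<close> with \<open>0 < t < 1\<close> arises from such an \<open>l\<close>, as long as the block has a nonzero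
eigenvalue. The condition on the kernels guarantees this (\<open>block_eigenvalue\<close>).
\<close>

section \<open>The inner product\<close>

lemma cip_add_left [simp]:
  fixes x y z :: "complex Matrix.vec"
  assumes "dim_vec x = dim_vec z" "dim_vec y = dim_vec z"
  shows "(x + y) \<bullet>c z = x \<bullet>c z + y \<bullet>c z"
  using assms by (simp add: scalar_prod_def sum.distrib distrib_right)

lemma cip_diff_left [simp]:
  fixes x y z :: "complex Matrix.vec"
  assumes "dim_vec x = dim_vec z" "dim_vec y = dim_vec z"
  shows "(x - y) \<bullet>c z = x \<bullet>c z - y \<bullet>c z"
  using assms by (simp add: scalar_prod_def sum_subtractf left_diff_distrib)

lemma cip_add_right [simp]:
  fixes x y z :: "complex Matrix.vec"
  assumes "dim_vec x = dim_vec z" "dim_vec y = dim_vec z"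
  shows "z \<bullet>c (x + y) = z \<bullet>c x + z \<bullet>c y"
  using assms by (simp add: scalar_prod_def sum.distrib distrib_left)

lemma cip_diff_right [simp]:
  fixes x y z :: "complex Matrix.vec"
  assumes "dim_vec x = dim_vec z" "dim_vec y = dim_vec z"
  shows "z \<bullet>c (x - y) = z \<bullet>c x - z \<bullet>c y"
  using assms by (simp add: scalar_prod_def sum_subtractf right_diff_distrib)

lemma cip_smult_right [simp]:
  fixes x z :: "complex Matrix.vec"
  assumes "dim_vec x = dim_vec z"
  shows "z \<bullet>c (k \<cdot>\<^sub>v x) = cnj k * (z \<bullet>c x)"
  using assms by (simp add: scalar_prod_def sum_distrib_left mult_ac)

lemma cip_commute:
  fixes x y :: "complex Matrix.vec"
  assumes "dim_vec x = dim_vec y"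
  shows "y \<bullet>c x = cnj (x \<bullet>c y)"
  using assms by (simp add: scalar_prod_def mult_ac)

lemma cip_self:
  fixes x :: "complex Matrix.vec"
  shows "x \<bullet>c x = complex_of_real (Re (x \<bullet>c x))" and "Re (x \<bullet>c x) \<ge> 0"
proof -
  have "x \<bullet>c x \<ge> 0" by (rule conjugate_square_ge_0_vec)
  then show "x \<bullet>c x = complex_of_real (Re (x \<bullet>c x))" and "Re (x \<bullet>c x) \<ge> 0"
    by (auto simp: less_eq_complex_def complex_eq_iff)
qed

lemma cip_self_eq_0:
  fixes x :: "complex Matrix.vec"
  assumes "x \<in> carrier_vec n"
  shows "x \<bullet>c x = 0 \<longleftrightarrow> x = 0\<^sub>v n"
  using assms by (rule conjugate_square_eq_0_vec)

lemma cip_self_pos: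
  fixes x :: "complex Matrix.vec"
  assumes "x \<in> carrier_vec n" "x \<noteq> 0\<^sub>v n"
  shows "Re (x \<bullet>c x) > 0"
  using cip_self[of x] cip_self_eq_0[OF assms(1)] assms(2)
  by (metis less_eq_real_def of_real_0)

lemma mat_vec_add [simp]:
  fixes X :: "complex mat"
  assumes "dim_vec x = dim_col X" "dim_vec y = dim_col X"
  shows "X *\<^sub>v (x + y) = X *\<^sub>v x + X *\<^sub>v y"
  using assms by (intro mult_add_distrib_mat_vec[of _ "dim_row X" "dim_col X"]) (auto intro: carrier_vecI)

lemma mat_vec_diff [simp]:
  fixes X :: "complex mat"
  assumes "dim_vec x = dim_col X" "dim_vec y = dim_col X"
  shows "X *\<^sub>v (x - y) = X *\<^sub>v x - X *\<^sub>v y"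
  using assms by (intro mult_minus_distrib_mat_vec[of _ "dim_row X" "dim_col X"]) (auto intro: carrier_vecI)

lemma mat_vec_smult [simp]:
  fixes X :: "complex mat"
  assumes "dim_vec x = dim_col X"
  shows "X *\<^sub>v (k \<cdot>\<^sub>v x) = k \<cdot>\<^sub>v (X *\<^sub>v x)"
  using assms by (intro mult_mat_vec[of _ "dim_row X" "dim_col X"]) (auto intro: carrier_vecI)

lemma mat_vec_index:
  fixes X :: "complex mat"
  assumes "i < dim_row X" "dim_vec x = dim_col X"
  shows "(X *\<^sub>v x) $ i = (\<Sum>j<dim_col X. X $$ (i, j) * x $ j)"
  using assms by (simp add: scalar_prod_def lessThan_atLeast0)

lemma adjoint_dims [simp]:
  "dim_row (mat_adjoint X) = dim_col X" "dim_col (mat_adjoint X) = dim_row X"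
  by (simp_all add: mat_adjoint_def)

lemma adjoint_index:
  fixes X :: "complex mat"
  assumes "i < dim_col X" "j < dim_row X"
  shows "mat_adjoint X $$ (i, j) = cnj (X $$ (j, i))"
  using assms by (simp add: mat_adjoint_def mat_of_rows_def)

lemma cip_adjoint:
  fixes X :: "complex mat"
  assumes X: "X \<in> carrier_mat n n" and x: "x \<in> carrier_vec n" and y: "y \<in> carrier_vec n"
  shows "(X *\<^sub>v x) \<bullet>c y = x \<bullet>c (mat_adjoint X *\<^sub>v y)"
proof -
  have d: "dim_row X = n" "dim_col X = n" "dim_vec x = n" "dim_vec y = n"
    using X x y by auto
  have "(X *\<^sub>v x) \<bullet>c y = (\<Sum>i<n. (\<Sum>j<n. X $$ (i, j) * x $ j) * cnj (y $ i))"
    using d by (simp add: scalar_prod_def lessThan_atLeast0)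
  also have "\<dots> = (\<Sum>j<n. \<Sum>i<n. X $$ (i, j) * x $ j * cnj (y $ i))"
    by (subst sum.swap) (simp add: sum_distrib_right)
  also have "\<dots> = (\<Sum>j<n. x $ j * cnj (\<Sum>i<n. cnj (X $$ (i, j)) * y $ i))"
    by (simp add: sum_distrib_left mult_ac)
  also have "\<dots> = (\<Sum>j<n. x $ j * cnj ((mat_adjoint X *\<^sub>v y) $ j))"
    using d by (intro sum.cong refl) (simp add: mat_vec_index adjoint_index del: index_mult_mat_vec)
  also have "\<dots> = x \<bullet>c (mat_adjoint X *\<^sub>v y)"
    using d by (simp add: scalar_prod_def lessThan_atLeast0 del: index_mult_mat_vec)
  finally show ?thesis .
qed

(* This rule turns a component of X v into a scalar product before linearity in v can be used. *)
declare index_mult_mat_vec [simp del]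

section \<open>Convexity of the numerical range\<close>

lemma numerical_range_quotient:
  assumes X: "X \<in> carrier_mat n n" and x: "x \<in> carrier_vec n" "x \<noteq> 0\<^sub>v n"
  shows "((X *\<^sub>v x) \<bullet>c x) / (x \<bullet>c x) \<in> numerical_range X"
proof -
  define r where "r = Re (x \<bullet>c x)"
  have r: "r > 0" "x \<bullet>c x = complex_of_real r"
    using cip_self_pos[OF x] cip_self(1)[of x] by (simp_all add: r_def)
  define k where "k = complex_of_real (1 / sqrt r)"
  have kk: "k * cnj k = 1 / complex_of_real r"
    using r(1) by (simp add: k_def flip: of_real_mult)
  have d: "dim_row X = n" "dim_col X = n" "dim_vec x = n"
    using X x by auto
  have "(k \<cdot>\<^sub>v x) \<bullet>c (k \<cdot>\<^sub>v x) = (k * cnj k) * (x \<bullet>c x)"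
    by (simp add: mult_ac)
  then have 1: "(k \<cdot>\<^sub>v x) \<bullet>c (k \<cdot>\<^sub>v x) = 1"
    using r kk by simp
  have "(X *\<^sub>v (k \<cdot>\<^sub>v x)) \<bullet>c (k \<cdot>\<^sub>v x) = (k * cnj k) * ((X *\<^sub>v x) \<bullet>c x)"
    using d by (simp add: mult_ac)
  then have 2: "((X *\<^sub>v x) \<bullet>c x) / (x \<bullet>c x) = (X *\<^sub>v (k \<cdot>\<^sub>v x)) \<bullet>c (k \<cdot>\<^sub>v x)"
    using r kk by simp
  have 3: "k \<cdot>\<^sub>v x \<in> carrier_vec (dim_col X)"
    using d by (auto intro: carrier_vecI)
  show ?thesis
    unfolding numerical_range_def using 1 2 3 by blast
qed

text \<open>The Toeplitz--Hausdorff theorem. For unit vectors \<open>x\<close>, \<open>y\<close> with different values \<open>p\<close>, \<open>q\<close>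
of the form, multiplying \<open>x\<close> by a phase \<open>\<mu>\<close> makes the affinely normalised form (value \<open>0\<close> at
\<open>x\<close>, \<open>1\<close> at \<open>y\<close>) real along the path \<open>(1 - s) \<mu> x + s y\<close>. The intermediate value theorem then
reaches every point of the segment from \<open>p\<close> to \<open>q\<close>.\<close>
theorem convex_numerical_range:
  assumes X: "X \<in> carrier_mat n n"
  shows "convex (numerical_range X)"
  unfolding convex_alt
proof (intro ballI allI impI)
  fix p q and \<tau> :: real
  assume pq: "p \<in> numerical_range X" "q \<in> numerical_range X" and \<tau>: "0 \<le> \<tau> \<and> \<tau> \<le> 1"
  obtain x where x: "x \<in> carrier_vec n" "x \<bullet>c x = 1" and p: "p = (X *\<^sub>v x) \<bullet>c x"
    using pq(1) X unfolding numerical_range_def by auto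
  obtain y where y: "y \<in> carrier_vec n" "y \<bullet>c y = 1" and q: "q = (X *\<^sub>v y) \<bullet>c y"
    using pq(2) X unfolding numerical_range_def by auto
  have d: "dim_row X = n" "dim_col X = n" "dim_vec x = n" "dim_vec y = n"
    using X x y by auto
  show "(1 - \<tau>) *\<^sub>R p + \<tau> *\<^sub>R q \<in> numerical_range X"
  proof (cases "p = q")
    case True
    then show ?thesis using pq by (simp add: scaleR_left_diff_distrib)
  next
    case False
    define e where "e = q - p"
    have e: "e \<noteq> 0" using False by (simp add: e_def)
    define g where "g = ((X *\<^sub>v x) \<bullet>c y - p * (x \<bullet>c y)) / e"
    define h where "h = ((X *\<^sub>v y) \<bullet>c x - p * (y \<bullet>c x)) / e"
    \<comment> \<open>The cross term \<open>\<mu> g + cnj \<mu> h\<close> is real for the phase that makes \<open>\<mu> (g - cnj h)\<close> real.\<close>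
    define w where "w = g - cnj h"
    define \<mu> where "\<mu> = (if w = 0 then 1 else cnj w / norm w)"
    have ww: "cnj w * w = complex_of_real (norm w) * complex_of_real (norm w)"
      using complex_norm_square[of w] by (simp add: power2_eq_square mult.commute)
    have \<mu>: "\<mu> * cnj \<mu> = 1"
    proof (cases "w = 0")
      case False
      have "\<mu> * cnj \<mu> = (cnj w * w) / (complex_of_real (norm w) * complex_of_real (norm w))"
        using False by (simp add: \<mu>_def)
      then show ?thesis unfolding ww using False by simp
    qed (simp add: \<mu>_def)
    have "\<mu> * w = complex_of_real (norm w)"
    proof (cases "w = 0")
      case False
      have "\<mu> * w = (cnj w * w) / complex_of_real (norm w)"
        using False by (simp add: \<mu>_def)
      then show ?thesis unfolding ww using False by simp
    qed simp
    then have "Im (\<mu> * (g - cnj h)) = 0"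
      by (simp add: w_def)
    then have im: "Im (\<mu> * g + cnj \<mu> * h) = 0"
      by (simp add: algebra_simps)
    define r where "r = Re (\<mu> * g + cnj \<mu> * h)"
    have r: "\<mu> * g + cnj \<mu> * h = complex_of_real r"
      using im by (simp add: r_def complex_eq_iff)
    define \<rho> where "\<rho> = Re (\<mu> * (x \<bullet>c y))"
    define z where "z s = (complex_of_real (1 - s) * \<mu>) \<cdot>\<^sub>v x + complex_of_real s \<cdot>\<^sub>v y" for s
    have zc: "z s \<in> carrier_vec n" for s
      using d by (auto simp: z_def intro: carrier_vecI)
    have yx: "y \<bullet>c x = cnj (x \<bullet>c y)"
      using d by (intro cip_commute) simp
    have \<rho>: "\<mu> * (x \<bullet>c y) + cnj \<mu> * (y \<bullet>c x) = complex_of_real (2 * \<rho>)"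
      unfolding yx \<rho>_def by (simp add: complex_eq_iff)
    have zz: "z s \<bullet>c z s = complex_of_real ((1 - s)\<^sup>2 + s\<^sup>2 + s * (1 - s) * (2 * \<rho>))" for s
    proof -
      have "z s \<bullet>c z s = of_real (1 - s) ^ 2 * (\<mu> * cnj \<mu>) * (x \<bullet>c x) + of_real s ^ 2 * (y \<bullet>c y)
        + of_real s * of_real (1 - s) * (\<mu> * (x \<bullet>c y) + cnj \<mu> * (y \<bullet>c x))"
        using d by (simp add: z_def algebra_simps power2_eq_square)
      then show ?thesis unfolding \<rho> \<mu> x(2) y(2) by simp
    qed
    have gh: "(X *\<^sub>v x) \<bullet>c y = e * g + p * (x \<bullet>c y)" "(X *\<^sub>v y) \<bullet>c x = e * h + p * (y \<bullet>c x)"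
      using e by (simp_all add: g_def h_def)
    have Xz: "(X *\<^sub>v z s) \<bullet>c z s = p * (z s \<bullet>c z s) + e * complex_of_real (s\<^sup>2 + s * (1 - s) * r)" for s
    proof -
      have "(X *\<^sub>v z s) \<bullet>c z s = of_real (1 - s) ^ 2 * (\<mu> * cnj \<mu>) * p + of_real s ^ 2 * q
        + of_real s * of_real (1 - s) * (\<mu> * ((X *\<^sub>v x) \<bullet>c y) + cnj \<mu> * ((X *\<^sub>v y) \<bullet>c x))"
        using d by (simp add: z_def p q algebra_simps power2_eq_square)
      also have "\<mu> * ((X *\<^sub>v x) \<bullet>c y) + cnj \<mu> * ((X *\<^sub>v y) \<bullet>c x)
          = e * (\<mu> * g + cnj \<mu> * h) + p * (\<mu> * (x \<bullet>c y) + cnj \<mu> * (y \<bullet>c x))"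
        unfolding gh by (simp add: algebra_simps)
      also have "q = p + e" by (simp add: e_def)
      finally show ?thesis unfolding r \<rho> \<mu> zz by (simp add: algebra_simps)
    qed
    \<comment> \<open>A root of this quadratic, cleared of the denominator \<open>z s \<bullet>c z s\<close>, puts the value of the form
      at the fraction \<open>\<tau>\<close> of the segment.\<close>
    define f where "f s = s\<^sup>2 + s * (1 - s) * r - \<tau> * ((1 - s)\<^sup>2 + s\<^sup>2 + s * (1 - s) * (2 * \<rho>))" for s
    have "\<exists>s\<ge>0. s \<le> 1 \<and> f s = 0"
    proof (rule IVT')
      show "f 0 \<le> 0" "0 \<le> f 1" using \<tau> by (simp_all add: f_def)
      show "continuous_on {0..1} f" unfolding f_def by (intro continuous_intros)
    qed simp
    then obtain s where s: "0 \<le> s" "s \<le> 1" "f s = 0" by blast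
    have nz: "z s \<noteq> 0\<^sub>v n"
    proof
      assume z0: "z s = 0\<^sub>v n"
      have y': "complex_of_real s \<cdot>\<^sub>v y = (- (complex_of_real (1 - s) * \<mu>)) \<cdot>\<^sub>v x"
      proof (intro eq_vecI)
        fix i assume "i < dim_vec ((- (complex_of_real (1 - s) * \<mu>)) \<cdot>\<^sub>v x)"
        then have i: "i < n" using d by simp
        have "z s $ i = 0" using z0 i by simp
        then show "(complex_of_real s \<cdot>\<^sub>v y) $ i = ((- (complex_of_real (1 - s) * \<mu>)) \<cdot>\<^sub>v x) $ i"
          using i d by (simp add: z_def eq_neg_iff_add_eq_0 add.commute)
      qed (use d in simp)
      have "of_real s ^ 2 * (y \<bullet>c y) = (complex_of_real s \<cdot>\<^sub>v y) \<bullet>c (complex_of_real s \<cdot>\<^sub>v y)"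
        by (simp add: power2_eq_square)
      also have "\<dots> = of_real (1 - s) ^ 2 * (\<mu> * cnj \<mu>) * (x \<bullet>c x)"
        unfolding y' by (simp add: power2_eq_square)
      finally have 1: "complex_of_real s ^ 2 = of_real (1 - s) ^ 2"
        using x y \<mu> by simp
      have "of_real s ^ 2 * q = (X *\<^sub>v (complex_of_real s \<cdot>\<^sub>v y)) \<bullet>c (complex_of_real s \<cdot>\<^sub>v y)"
        using d by (simp add: q power2_eq_square)
      also have "\<dots> = of_real (1 - s) ^ 2 * (\<mu> * cnj \<mu>) * p"
        unfolding y' using d by (simp add: p power2_eq_square)
      finally have "of_real s ^ 2 * q = of_real s ^ 2 * p"
        using \<mu> 1 by simp
      then have "s = 0" using False by simp
      then show False using 1 by simp
    qed
    have \<nu>: "z s \<bullet>c z s \<noteq> 0"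
      using nz cip_self_eq_0[OF zc] by simp
    have "(X *\<^sub>v z s) \<bullet>c z s = p * (z s \<bullet>c z s) + e * (of_real \<tau> * (z s \<bullet>c z s))"
      using s(3) unfolding Xz zz of_real_mult[symmetric] by (simp add: f_def)
    then have "((X *\<^sub>v z s) \<bullet>c z s) / (z s \<bullet>c z s) = p + e * of_real \<tau>"
      using \<nu> by (simp add: field_simps)
    also have "\<dots> = (1 - \<tau>) *\<^sub>R p + \<tau> *\<^sub>R q"
      by (simp add: e_def scaleR_conv_of_real algebra_simps)
    finally show ?thesis
      using numerical_range_quotient[OF X zc nz] by simp
  qed
qed

section \<open>Spectral decomposition of normal matrices\<close>

text \<open>Componentwise, so that sums of vectors need neither an abelian group on the type nor a side
condition on dimensions.\<close>
definition vsum :: "nat \<Rightarrow> ('i \<Rightarrow> complex Matrix.vec) \<Rightarrow> 'i set \<Rightarrow> complex Matrix.vec" where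
  "vsum n F I = Matrix.vec n (\<lambda>i. \<Sum>k\<in>I. F k $ i)"

lemma vsum_carrier [simp]: "vsum n F I \<in> carrier_vec n" and dim_vsum [simp]: "dim_vec (vsum n F I) = n"
  and vsum_index [simp]: "i < n \<Longrightarrow> vsum n F I $ i = (\<Sum>k\<in>I. F k $ i)"
  by (simp_all add: vsum_def)

lemma mat_vec_vsum:
  fixes X :: "complex mat"
  assumes X: "X \<in> carrier_mat n n" and F: "\<And>k. k \<in> I \<Longrightarrow> F k \<in> carrier_vec n"
  shows "X *\<^sub>v vsum n F I = vsum n (\<lambda>k. X *\<^sub>v F k) I"
proof (rule eq_vecI)
  fix i assume "i < dim_vec (vsum n (\<lambda>k. X *\<^sub>v F k) I)"
  then have i: "i < n" by simp
  have "(X *\<^sub>v vsum n F I) $ i = (\<Sum>j<n. \<Sum>k\<in>I. X $$ (i, j) * F k $ j)"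
    using i X by (simp add: mat_vec_index sum_distrib_left)
  also have "\<dots> = (\<Sum>k\<in>I. \<Sum>j<n. X $$ (i, j) * F k $ j)"
    by (rule sum.swap)
  also have "\<dots> = (\<Sum>k\<in>I. (X *\<^sub>v F k) $ i)"
  proof (rule sum.cong)
    fix k assume "k \<in> I"
    then have "dim_vec (F k) = n" using F by auto
    then show "(\<Sum>j<n. X $$ (i, j) * F k $ j) = (X *\<^sub>v F k) $ i"
      using i X by (simp add: mat_vec_index)
  qed simp
  finally show "(X *\<^sub>v vsum n F I) $ i = vsum n (\<lambda>k. X *\<^sub>v F k) I $ i"
    using i by simp
qed (use X in simp)

lemma cip_vsum_left:
  assumes F: "\<And>k. k \<in> I \<Longrightarrow> F k \<in> carrier_vec n" and y: "y \<in> carrier_vec n"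
  shows "vsum n F I \<bullet>c y = (\<Sum>k\<in>I. F k \<bullet>c y)"
proof -
  have "vsum n F I \<bullet>c y = (\<Sum>i\<in>{0..<n}. \<Sum>k\<in>I. F k $ i * cnj (y $ i))"
    using y by (simp add: scalar_prod_def sum_distrib_right)
  also have "\<dots> = (\<Sum>k\<in>I. \<Sum>i\<in>{0..<n}. F k $ i * cnj (y $ i))"
    by (rule sum.swap)
  also have "\<dots> = (\<Sum>k\<in>I. F k \<bullet>c y)"
    using y F by (intro sum.cong) (simp_all add: scalar_prod_def)
  finally show ?thesis .
qed

lemma cip_vsum_right:
  assumes F: "\<And>k. k \<in> I \<Longrightarrow> F k \<in> carrier_vec n" and y: "y \<in> carrier_vec n"
  shows "y \<bullet>c vsum n F I = (\<Sum>k\<in>I. y \<bullet>c F k)"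
proof -
  have "y \<bullet>c vsum n F I = cnj (vsum n F I \<bullet>c y)"
    using y by (intro cip_commute) simp
  also have "\<dots> = (\<Sum>k\<in>I. cnj (F k \<bullet>c y))"
    by (simp add: cip_vsum_left[OF F y])
  also have "\<dots> = (\<Sum>k\<in>I. y \<bullet>c F k)"
    using F y by (intro sum.cong cip_commute[symmetric]) auto
  finally show ?thesis .
qed

text \<open>A normal matrix together with its adjoint, given by the identities on vectors that the
arguments below use; a self-adjoint matrix is the case \<open>N' = N\<close>.\<close>
locale normal_pair =
  fixes n :: nat and N N' :: "complex mat"
  assumes carriers: "N \<in> carrier_mat n n" "N' \<in> carrier_mat n n"
    and adjoint: "\<And>x y. x \<in> carrier_vec n \<Longrightarrow> y \<in> carrier_vec n \<Longrightarrow> (N *\<^sub>v x) \<bullet>c y = x \<bullet>c (N' *\<^sub>v y)"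
    and commute: "\<And>x. x \<in> carrier_vec n \<Longrightarrow> N *\<^sub>v (N' *\<^sub>v x) = N' *\<^sub>v (N *\<^sub>v x)"
begin

lemma dims [simp]: "dim_row N = n" "dim_col N = n" "dim_row N' = n" "dim_col N' = n"
  using carriers by auto

lemma closed [simp]: "N *\<^sub>v x \<in> carrier_vec n" "N' *\<^sub>v x \<in> carrier_vec n"
  by (auto intro: carrier_vecI)

text \<open>The norm of \<open>N' y - cnj e y\<close> equals that of \<open>N y - e y\<close>, because \<open>N\<close> commutes with \<open>N'\<close>.\<close>
lemma eigen_adjoint:
  assumes y: "y \<in> carrier_vec n" and ev: "N *\<^sub>v y = e \<cdot>\<^sub>v y"
  shows "N' *\<^sub>v y = cnj e \<cdot>\<^sub>v y"
proof -
  define z where "z = N' *\<^sub>v y - cnj e \<cdot>\<^sub>v y"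
  have d: "dim_vec y = n" using y by auto
  have z: "z \<in> carrier_vec n" using d by (auto simp: z_def intro: carrier_vecI)
  have 1: "(N' *\<^sub>v y) \<bullet>c (N' *\<^sub>v y) = e * ((N' *\<^sub>v y) \<bullet>c y)"
    using adjoint[of "N' *\<^sub>v y" y] y commute[OF y] ev d by simp
  have 2: "y \<bullet>c (N' *\<^sub>v y) = e * (y \<bullet>c y)"
    using adjoint[of y y] y ev by simp
  have "z \<bullet>c z = 0"
    unfolding z_def using d by (simp add: 1 2 algebra_simps)
  then have z0: "z = 0\<^sub>v n" using cip_self_eq_0[OF z] by simp
  show ?thesis
  proof (rule eq_vecI)
    fix i assume "i < dim_vec (cnj e \<cdot>\<^sub>v y)"
    then have i: "i < n" using d by simp
    then have "z $ i = 0" by (simp add: z0)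
    then show "(N' *\<^sub>v y) $ i = (cnj e \<cdot>\<^sub>v y) $ i"
      using i d by (simp add: z_def)
  qed (use d in simp)
qed

lemma eigen_orthogonal:
  assumes "x \<in> carrier_vec n" "y \<in> carrier_vec n" "N *\<^sub>v x = k \<cdot>\<^sub>v x" "N *\<^sub>v y = l \<cdot>\<^sub>v y" "k \<noteq> l"
  shows "x \<bullet>c y = 0"
proof -
  have "k * (x \<bullet>c y) = (N *\<^sub>v x) \<bullet>c y" using assms by simp
  also have "\<dots> = x \<bullet>c (N' *\<^sub>v y)" using adjoint assms by blast
  also have "\<dots> = l * (x \<bullet>c y)" using eigen_adjoint[OF assms(2,4)] assms by simp
  finally show ?thesis using assms(5) by simp
qed

text \<open>The vector \<open>y\<close> is in the range of \<open>N - e\<close>, hence orthogonal to the kernel of its adjoint, and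
by \<open>eigen_adjoint\<close> it is itself in that kernel.\<close>
lemma no_generalised_eigenvectors:
  assumes x: "x \<in> carrier_vec n" and y: "y = N *\<^sub>v x - e \<cdot>\<^sub>v x" and ev: "N *\<^sub>v y = e \<cdot>\<^sub>v y"
  shows "y = 0\<^sub>v n"
proof -
  have d: "dim_vec x = n" using x by auto
  have yc: "y \<in> carrier_vec n" unfolding y using d by (auto intro: carrier_vecI)
  have "y \<bullet>c y = (N *\<^sub>v x) \<bullet>c y - e * (x \<bullet>c y)"
    using d yc by (subst (1) y) simp
  also have "\<dots> = 0"
    using adjoint[OF x yc] eigen_adjoint[OF yc ev] x yc by simp
  finally show ?thesis using cip_self_eq_0[OF yc] by simp
qed

text \<open>Indexing the summands by eigenvalues, at most one eigenvector for each, makes them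
pairwise orthogonal.\<close>
definition eigensum :: "complex Matrix.vec \<Rightarrow> bool" where
  "eigensum x \<longleftrightarrow> (\<exists>F. (\<forall>e\<in>spectrum N. F e \<in> carrier_vec n \<and> N *\<^sub>v F e = e \<cdot>\<^sub>v F e)
     \<and> x = vsum n F (spectrum N))"

lemma eigensum_combination:
  assumes "\<And>i. i \<in> I \<Longrightarrow> eigensum (g i)"
  shows "eigensum (vsum n (\<lambda>i. c i \<cdot>\<^sub>v g i) I)"
proof -
  have "\<forall>i\<in>I. \<exists>F. (\<forall>e\<in>spectrum N. F e \<in> carrier_vec n \<and> N *\<^sub>v F e = e \<cdot>\<^sub>v F e)
     \<and> g i = vsum n F (spectrum N)"
    using assms by (simp add: eigensum_def)
  then obtain G where G: "\<And>i e. i \<in> I \<Longrightarrow> e \<in> spectrum N \<Longrightarrow>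
      G i e \<in> carrier_vec n \<and> N *\<^sub>v G i e = e \<cdot>\<^sub>v G i e"
    and g: "\<And>i. i \<in> I \<Longrightarrow> g i = vsum n (G i) (spectrum N)"
    by (metis (no_types, lifting))
  have dG: "dim_vec (G i e) = n" if "i \<in> I" "e \<in> spectrum N" for i e
    using G that by auto
  show ?thesis
    unfolding eigensum_def
  proof (intro exI[of _ "\<lambda>e. vsum n (\<lambda>i. c i \<cdot>\<^sub>v G i e) I"] conjI ballI)
    fix e assume e: "e \<in> spectrum N"
    have "N *\<^sub>v vsum n (\<lambda>i. c i \<cdot>\<^sub>v G i e) I = vsum n (\<lambda>i. N *\<^sub>v (c i \<cdot>\<^sub>v G i e)) I"
      using G e by (intro mat_vec_vsum carriers) simp
    also have "\<dots> = e \<cdot>\<^sub>v vsum n (\<lambda>i. c i \<cdot>\<^sub>v G i e) I"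
    proof (rule eq_vecI)
      fix j assume "j < dim_vec (e \<cdot>\<^sub>v vsum n (\<lambda>i. c i \<cdot>\<^sub>v G i e) I)"
      then have j: "j < n" by simp
      have "(N *\<^sub>v (c i \<cdot>\<^sub>v G i e)) $ j = e * (c i \<cdot>\<^sub>v G i e) $ j" if "i \<in> I" for i
        using G[OF that e] j by (simp add: dG[OF that e])
      then show "vsum n (\<lambda>i. N *\<^sub>v (c i \<cdot>\<^sub>v G i e)) I $ j
          = (e \<cdot>\<^sub>v vsum n (\<lambda>i. c i \<cdot>\<^sub>v G i e) I) $ j"
        using j by (simp add: sum_distrib_left)
    qed simp
    finally show "N *\<^sub>v vsum n (\<lambda>i. c i \<cdot>\<^sub>v G i e) I = e \<cdot>\<^sub>v vsum n (\<lambda>i. c i \<cdot>\<^sub>v G i e) I" .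
  next
    show "vsum n (\<lambda>i. c i \<cdot>\<^sub>v g i) I = vsum n (\<lambda>e. vsum n (\<lambda>i. c i \<cdot>\<^sub>v G i e) I) (spectrum N)"
    proof (rule eq_vecI)
      fix j assume "j < dim_vec (vsum n (\<lambda>e. vsum n (\<lambda>i. c i \<cdot>\<^sub>v G i e) I) (spectrum N))"
      then have j: "j < n" by simp
      have "vsum n (\<lambda>i. c i \<cdot>\<^sub>v g i) I $ j = (\<Sum>i\<in>I. \<Sum>e\<in>spectrum N. c i * G i e $ j)"
        using j by (simp add: g sum_distrib_left)
      also have "\<dots> = (\<Sum>e\<in>spectrum N. \<Sum>i\<in>I. c i * G i e $ j)"
        by (rule sum.swap)
      finally show "vsum n (\<lambda>i. c i \<cdot>\<^sub>v g i) I $ j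
          = vsum n (\<lambda>e. vsum n (\<lambda>i. c i \<cdot>\<^sub>v G i e) I) (spectrum N) $ j"
        using j dG by simp
    qed simp
  qed simp
qed

text \<open>On the eigenvectors for \<open>l \<noteq> e\<close> the operator \<open>N - e\<close> can be inverted by division by \<open>l - e\<close>.
Subtracting this preimage from \<open>x\<close> leaves a vector \<open>w\<close> for which \<open>(N - e) w\<close> is an
eigenvector for \<open>e\<close>; there are no generalised eigenvectors, so \<open>w\<close> is an eigenvector.\<close>
lemma eigensum_shift:
  assumes x: "x \<in> carrier_vec n" and D: "eigensum (N *\<^sub>v x - e \<cdot>\<^sub>v x)"
  shows "eigensum x"
proof -
  let ?L = "spectrum N"
  have fin: "finite ?L" using card_finite_spectrum[OF carriers(1)] by simp
  obtain F where F: "\<And>l. l \<in> ?L \<Longrightarrow> F l \<in> carrier_vec n" "\<And>l. l \<in> ?L \<Longrightarrow> N *\<^sub>v F l = l \<cdot>\<^sub>v F l"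
    and Dx: "N *\<^sub>v x - e \<cdot>\<^sub>v x = vsum n F ?L"
    using D unfolding eigensum_def by auto
  have dF: "dim_vec (F l) = n" if "l \<in> ?L" for l using F that by auto
  have dx: "dim_vec x = n" using x by auto
  define G where "G l = (1 / (l - e)) \<cdot>\<^sub>v F l" for l
  have dG: "dim_vec (G l) = n" and NG: "N *\<^sub>v G l = l \<cdot>\<^sub>v G l" if "l \<in> ?L" for l
    using dF[OF that] F(2)[OF that] by (simp_all add: G_def smult_smult_assoc mult.commute)
  define w where "w = x - vsum n G (?L - {e})"
  define y where "y = N *\<^sub>v w - e \<cdot>\<^sub>v w"
  have w: "w \<in> carrier_vec n" using dx by (auto simp: w_def intro: carrier_vecI)
  have dw: "dim_vec w = n" using w by auto
  have NG': "N *\<^sub>v vsum n G (?L - {e}) = vsum n (\<lambda>l. l \<cdot>\<^sub>v G l) (?L - {e})"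
    using NG dG by (subst mat_vec_vsum[OF carriers(1)])
      (auto intro: carrier_vecI simp: vsum_def intro!: sum.cong)
  have y_index: "y $ i = (\<Sum>l\<in>?L. F l $ i) - (\<Sum>l\<in>?L - {e}. F l $ i)" if i: "i < n" for i
  proof -
    have "y $ i = (N *\<^sub>v x - e \<cdot>\<^sub>v x) $ i
        - ((\<Sum>l\<in>?L - {e}. l * G l $ i) - e * (\<Sum>l\<in>?L - {e}. G l $ i))"
      using i dx dG by (simp add: y_def w_def NG' algebra_simps)
    also have "(\<Sum>l\<in>?L - {e}. l * G l $ i) - e * (\<Sum>l\<in>?L - {e}. G l $ i) = (\<Sum>l\<in>?L - {e}. F l $ i)"
      unfolding sum_distrib_left sum_subtractf[symmetric]
    proof (rule sum.cong)
      fix l assume l: "l \<in> ?L - {e}"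
      have "l * G l $ i - e * G l $ i = (l - e) * G l $ i" by (simp add: algebra_simps)
      also have "\<dots> = F l $ i" using l i dF by (simp add: G_def)
      finally show "l * G l $ i - e * G l $ i = F l $ i" .
    qed simp
    finally show ?thesis using i by (simp add: Dx)
  qed
  have y: "y = (if e \<in> ?L then F e else 0\<^sub>v n)"
  proof (rule eq_vecI)
    fix i assume "i < dim_vec (if e \<in> ?L then F e else 0\<^sub>v n)"
    then have i: "i < n" using dF by (auto split: if_splits)
    show "y $ i = (if e \<in> ?L then F e else 0\<^sub>v n) $ i"
      unfolding y_index[OF i] using i fin by (auto simp: sum.remove[of ?L e])
  qed (use dF dw in \<open>auto simp: y_def\<close>)
  have "N *\<^sub>v 0\<^sub>v n = e \<cdot>\<^sub>v 0\<^sub>v n"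
    by (intro eq_vecI) (simp_all add: mat_vec_index)
  then have "N *\<^sub>v y = e \<cdot>\<^sub>v y"
    using F(2)[of e] unfolding y by (cases "e \<in> ?L") simp_all
  then have y0: "y = 0\<^sub>v n"
    using no_generalised_eigenvectors[OF w y_def] by simp
  have Nw: "N *\<^sub>v w = e \<cdot>\<^sub>v w"
  proof (rule eq_vecI)
    fix i assume "i < dim_vec (e \<cdot>\<^sub>v w)"
    then have i: "i < n" using dw by simp
    then have "y $ i = 0" by (simp add: y0)
    then show "(N *\<^sub>v w) $ i = (e \<cdot>\<^sub>v w) $ i"
      using i dw by (simp add: y_def)
  qed (use dw in simp)
  have w0: "w = 0\<^sub>v n" if "e \<notin> ?L"
    using that Nw w by (auto simp: spectrum_def eigenvalue_def eigenvector_def)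
  define H where "H l = (if l = e then w else G l)" for l
  have "x = vsum n H ?L"
  proof (rule eq_vecI)
    fix i assume "i < dim_vec (vsum n H ?L)"
    then have i: "i < n" by simp
    have xi: "x $ i = w $ i + (\<Sum>l\<in>?L - {e}. G l $ i)"
      using i dx by (simp add: w_def)
    have "(\<Sum>l\<in>?L - {e}. H l $ i) = (\<Sum>l\<in>?L - {e}. G l $ i)"
      by (rule sum.cong) (auto simp: H_def)
    then show "x $ i = vsum n H ?L $ i"
      using i fin w0 by (cases "e \<in> ?L") (simp_all add: xi sum.remove[of ?L e] H_def)
  qed (use dx in simp)
  moreover have "\<forall>l\<in>?L. H l \<in> carrier_vec n \<and> N *\<^sub>v H l = l \<cdot>\<^sub>v H l"
    using w Nw NG dG by (auto simp: H_def intro: carrier_vecI)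
  ultimately show ?thesis
    unfolding eigensum_def by blast
qed

text \<open>In a triangular form of \<open>N\<close>, the matrix maps each basis vector to a multiple of itself plus a
combination of earlier ones. By the shift lemma the basis vectors are therefore sums of
eigenvectors, one after the other. The basis need not be orthonormal.\<close>
theorem spectral_decomposition:
  assumes x: "x \<in> carrier_vec n"
  shows "eigensum x"
proof -
  obtain as where "char_poly N = (\<Prod>a\<leftarrow>as. [:- a, 1:])"
    using char_poly_factorized[OF carriers(1)] by blast
  then obtain T where T: "T \<in> carrier_mat n n" "upper_triangular T" "similar_mat N T"
    using schur_decomposition_exists[OF carriers(1)] by blast
  then obtain U V where wit: "similar_mat_wit N T U V"
    unfolding similar_mat_def by blast
  note sim = similar_mat_witD2[OF carriers(1) wit]
  have UVx: "U *\<^sub>v (V *\<^sub>v v) = v" if "v \<in> carrier_vec n" for v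
    using assoc_mult_mat_vec[OF sim(6,7) that] that by (simp add: sim(1))
  have NU: "N * U = U * T"
  proof -
    have "N * U = U * T * (V * U)"
      unfolding sim(3) by (intro assoc_mult_mat[of _ n n _ n _ n] mult_carrier_mat[of _ n n] sim)
    then show ?thesis using sim(2,5,6) by simp
  qed
  have dU: "dim_row U = n" "dim_col U = n" "dim_row T = n" "dim_col T = n" "dim_row V = n"
    using sim T by auto
  have cols: "eigensum (col U k)" if "k < n" for k
    using that
  proof (induction k rule: less_induct)
    case (less k)
    have "N *\<^sub>v col U k - T $$ (k, k) \<cdot>\<^sub>v col U k = vsum n (\<lambda>i. T $$ (i, k) \<cdot>\<^sub>v col U i) {..<k}"
    proof (rule eq_vecI)
      fix r assume "r < dim_vec (vsum n (\<lambda>i. T $$ (i, k) \<cdot>\<^sub>v col U i) {..<k})"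
      then have r: "r < n" by simp
      have "(N *\<^sub>v col U k) $ r = (N * U) $$ (r, k)"
        using r less.prems dU by (simp add: index_mult_mat_vec)
      also have "\<dots> = (\<Sum>i<n. U $$ (r, i) * T $$ (i, k))"
        unfolding NU using r less.prems dU by (simp add: scalar_prod_def lessThan_atLeast0)
      also have "\<dots> = (\<Sum>i<Suc k. U $$ (r, i) * T $$ (i, k))"
        using less.prems T dU by (intro sum.mono_neutral_right) (auto simp: upper_triangular_def)
      finally show "(N *\<^sub>v col U k - T $$ (k, k) \<cdot>\<^sub>v col U k) $ r
          = vsum n (\<lambda>i. T $$ (i, k) \<cdot>\<^sub>v col U i) {..<k} $ r"
        using r less.prems dU by (simp add: mult.commute)
    qed (use dU in simp)
    moreover have "eigensum (vsum n (\<lambda>i. T $$ (i, k) \<cdot>\<^sub>v col U i) {..<k})"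
      using less by (intro eigensum_combination) auto
    ultimately have "eigensum (N *\<^sub>v col U k - T $$ (k, k) \<cdot>\<^sub>v col U k)"
      by simp
    moreover have "col U k \<in> carrier_vec n"
      using dU less.prems by (auto intro: carrier_vecI)
    ultimately show ?case
      using eigensum_shift by blast
  qed
  have "x = vsum n (\<lambda>i. (V *\<^sub>v x) $ i \<cdot>\<^sub>v col U i) {..<n}"
  proof (rule eq_vecI)
    fix r assume "r < dim_vec (vsum n (\<lambda>i. (V *\<^sub>v x) $ i \<cdot>\<^sub>v col U i) {..<n})"
    then have r: "r < n" by simp
    have "x $ r = (U *\<^sub>v (V *\<^sub>v x)) $ r" using UVx[OF x] by simp
    also have "\<dots> = (\<Sum>i<n. U $$ (r, i) * (V *\<^sub>v x) $ i)"
      using r dU by (simp add: mat_vec_index)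
    finally show "x $ r = vsum n (\<lambda>i. (V *\<^sub>v x) $ i \<cdot>\<^sub>v col U i) {..<n} $ r"
      using r dU by (simp add: mult.commute)
  qed (use x in simp)
  moreover have "eigensum (vsum n (\<lambda>i. (V *\<^sub>v x) $ i \<cdot>\<^sub>v col U i) {..<n})"
    using cols by (intro eigensum_combination) auto
  ultimately show ?thesis by simp
qed

end

section \<open>Two orthogonal projections\<close>

lemma cip_Cauchy_Schwarz:
  fixes x y :: "complex Matrix.vec"
  assumes d: "dim_vec x = dim_vec y"
  shows "(norm (x \<bullet>c y))\<^sup>2 \<le> Re (x \<bullet>c x) * Re (y \<bullet>c y)"
proof -
  define p q where "p = Re (x \<bullet>c x)" and "q = Re (y \<bullet>c y)"
  have xx: "x \<bullet>c x = complex_of_real p" and yy: "y \<bullet>c y = complex_of_real q" and "p \<ge> 0" "q \<ge> 0"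
    unfolding p_def q_def by (rule cip_self)+
  define g where "g = x \<bullet>c y"
  have yx: "y \<bullet>c x = cnj g" unfolding g_def using d by (rule cip_commute)
  have gg: "cnj g * g = complex_of_real ((norm g)\<^sup>2)"
    using complex_norm_square[of g] by (simp add: mult.commute)
  have nonneg: "0 \<le> \<beta>\<^sup>2 * p - 2 * \<beta> * (norm g)\<^sup>2 + (norm g)\<^sup>2 * q" for \<beta> :: real
  proof -
    define v where "v = complex_of_real \<beta> \<cdot>\<^sub>v x - g \<cdot>\<^sub>v y"
    have "v \<bullet>c v = of_real \<beta> ^ 2 * (x \<bullet>c x) - of_real \<beta> * (cnj g * (x \<bullet>c y))
        - of_real \<beta> * (g * (y \<bullet>c x)) + (cnj g * g) * (y \<bullet>c y)"
      using d by (simp add: v_def algebra_simps power2_eq_square)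
    also have "\<dots> = complex_of_real (\<beta>\<^sup>2 * p - 2 * \<beta> * (norm g)\<^sup>2 + (norm g)\<^sup>2 * q)"
      unfolding xx yy yx g_def[symmetric] mult.commute[of g "cnj g"] gg by simp
    finally show ?thesis using cip_self(2)[of v] by simp
  qed
  show ?thesis
  proof (cases "q = 0")
    case True
    have "y \<in> carrier_vec (dim_vec y)" by (rule carrier_vecI) (rule refl)
    moreover have "y \<bullet>c y = 0" unfolding yy True by simp
    ultimately obtain k where "y = 0\<^sub>v k" using cip_self_eq_0 by blast
    then have "x \<bullet>c y = 0"
      by (simp add: scalar_prod_def)
    then show ?thesis using True by (simp add: q_def)
  next
    case False
    have "0 \<le> q * (q * p - (norm g)\<^sup>2)"
      using nonneg[of q] by (simp add: algebra_simps power2_eq_square)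
    then show ?thesis
      using False \<open>q \<ge> 0\<close> by (simp add: p_def[symmetric] q_def[symmetric] g_def[symmetric] zero_le_mult_iff mult.commute)
  qed
qed

text \<open>Two orthogonal projections in general position are classified by the angles between their
ranges. The operator \<open>H = (P + Q - 1)\<^sup>2\<close> below commutes with both, and its eigenvalues are the
squared cosines of these angles.\<close>
locale two_projections =
  fixes n :: nat and P Q :: "complex mat"
  assumes P: "P \<in> carrier_mat n n" and Q: "Q \<in> carrier_mat n n"
    and idem: "\<And>x. x \<in> carrier_vec n \<Longrightarrow> P *\<^sub>v (P *\<^sub>v x) = P *\<^sub>v x"
      "\<And>x. x \<in> carrier_vec n \<Longrightarrow> Q *\<^sub>v (Q *\<^sub>v x) = Q *\<^sub>v x"
    and selfadjoint:
      "\<And>x y. x \<in> carrier_vec n \<Longrightarrow> y \<in> carrier_vec n \<Longrightarrow> (P *\<^sub>v x) \<bullet>c y = x \<bullet>c (P *\<^sub>v y)"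
      "\<And>x y. x \<in> carrier_vec n \<Longrightarrow> y \<in> carrier_vec n \<Longrightarrow> (Q *\<^sub>v x) \<bullet>c y = x \<bullet>c (Q *\<^sub>v y)"
begin

lemma dims [simp]: "dim_row P = n" "dim_col P = n" "dim_row Q = n" "dim_col Q = n"
  using P Q by auto

lemma closed [simp]: "P *\<^sub>v x \<in> carrier_vec n" "Q *\<^sub>v x \<in> carrier_vec n"
  by (auto intro: carrier_vecI)

lemma PP [simp]: "dim_vec x = n \<Longrightarrow> P *\<^sub>v (P *\<^sub>v x) = P *\<^sub>v x"
  and QQ [simp]: "dim_vec x = n \<Longrightarrow> Q *\<^sub>v (Q *\<^sub>v x) = Q *\<^sub>v x"
  by (auto intro: idem carrier_vecI)

lemma P_zero [simp]: "P *\<^sub>v 0\<^sub>v n = 0\<^sub>v n"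
  by (intro eq_vecI) (simp_all add: mat_vec_index)

definition H :: "complex Matrix.vec \<Rightarrow> complex Matrix.vec" where
  "H x = x - P *\<^sub>v x - Q *\<^sub>v x + P *\<^sub>v (Q *\<^sub>v x) + Q *\<^sub>v (P *\<^sub>v x)"

lemma dim_H [simp]: "dim_vec (H x) = n"
  by (simp add: H_def)

definition E :: "complex \<Rightarrow> complex Matrix.vec set" where
  "E t = {x \<in> carrier_vec n. H x = t \<cdot>\<^sub>v x}"

lemma E_dim: "x \<in> E t \<Longrightarrow> dim_vec x = n" and E_carrier: "x \<in> E t \<Longrightarrow> x \<in> carrier_vec n"
  by (auto simp: E_def)

lemma E_index:
  assumes "x \<in> E t" "i < n"
  shows "x $ i - (P *\<^sub>v x) $ i - (Q *\<^sub>v x) $ i + (P *\<^sub>v (Q *\<^sub>v x)) $ i + (Q *\<^sub>v (P *\<^sub>v x)) $ i = t * x $ i"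
proof -
  have "H x $ i = (t \<cdot>\<^sub>v x) $ i" using assms(1) by (simp add: E_def)
  then show ?thesis using assms(2) E_dim[OF assms(1)] by (simp add: H_def)
qed

lemma H_P: "dim_vec x = n \<Longrightarrow> H (P *\<^sub>v x) = P *\<^sub>v (H x)"
  and H_Q: "dim_vec x = n \<Longrightarrow> H (Q *\<^sub>v x) = Q *\<^sub>v (H x)"
  by (intro eq_vecI; simp add: H_def)+

lemma H_add: "dim_vec x = n \<Longrightarrow> dim_vec y = n \<Longrightarrow> H (x + y) = H x + H y"
  and H_diff: "dim_vec x = n \<Longrightarrow> dim_vec y = n \<Longrightarrow> H (x - y) = H x - H y"
  and H_smult: "dim_vec x = n \<Longrightarrow> H (k \<cdot>\<^sub>v x) = k \<cdot>\<^sub>v H x"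
  by (intro eq_vecI; simp add: H_def algebra_simps)+

lemma E_P: "x \<in> E t \<Longrightarrow> P *\<^sub>v x \<in> E t" and E_Q: "x \<in> E t \<Longrightarrow> Q *\<^sub>v x \<in> E t"
  by (auto simp: E_def H_P H_Q)

lemma E_add: "x \<in> E t \<Longrightarrow> y \<in> E t \<Longrightarrow> x + y \<in> E t"
  and E_diff: "x \<in> E t \<Longrightarrow> y \<in> E t \<Longrightarrow> x - y \<in> E t"
  and E_smult: "x \<in> E t \<Longrightarrow> k \<cdot>\<^sub>v x \<in> E t"
  unfolding E_def
  by (auto simp: H_add H_diff H_smult intro!: eq_vecI) (simp_all add: algebra_simps)

lemma QPQ:
  assumes "x \<in> E t" "Q *\<^sub>v x = x"
  shows "Q *\<^sub>v (P *\<^sub>v x) = t \<cdot>\<^sub>v x"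
  using assms(2) E_index[OF assms(1)] E_dim[OF assms(1)] by (intro eq_vecI) auto

lemma H_selfadjoint:
  assumes "x \<in> carrier_vec n" "y \<in> carrier_vec n"
  shows "(H x) \<bullet>c y = x \<bullet>c (H y)"
proof -
  have d: "dim_vec x = n" "dim_vec y = n" using assms by auto
  show ?thesis
    unfolding H_def using assms by (simp add: d selfadjoint)
qed

text \<open>\<open>H\<close> is self-adjoint, so its eigenspaces give an orthogonal decomposition of the whole space that
\<open>P\<close> and \<open>Q\<close> respect.\<close>
lemma E_orthogonal_spectral:
  assumes x: "x \<in> carrier_vec n"
  obtains T F where "finite T" "\<And>t. t \<in> T \<Longrightarrow> F t \<in> E t" "x = vsum n F T"
    "\<And>s t. s \<in> T \<Longrightarrow> t \<in> T \<Longrightarrow> s \<noteq> t \<Longrightarrow> (\<And>u v. u \<in> E s \<Longrightarrow> v \<in> E t \<Longrightarrow> u \<bullet>c v = 0)"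
proof -
  define K where "K = 1\<^sub>m n - P - Q + P * Q + Q * P"
  have Kc: "K \<in> carrier_mat n n"
    unfolding K_def by (intro carrier_matI) simp_all
  have K: "K *\<^sub>v v = H v" if "v \<in> carrier_vec n" for v
  proof -
    have "dim_vec v = n" using that by simp
    have minus: "(X - Y) *\<^sub>v v = X *\<^sub>v v - Y *\<^sub>v v" if "X \<in> carrier_mat n n" "Y \<in> carrier_mat n n" for X Y
      using that \<open>v \<in> carrier_vec n\<close> by (intro minus_mult_distrib_mat_vec)
    have plus: "(X + Y) *\<^sub>v v = X *\<^sub>v v + Y *\<^sub>v v" if "X \<in> carrier_mat n n" "Y \<in> carrier_mat n n" for X Y
      using that \<open>v \<in> carrier_vec n\<close> by (intro add_mult_distrib_mat_vec)
    have "P * Q *\<^sub>v v = P *\<^sub>v (Q *\<^sub>v v)" "Q * P *\<^sub>v v = Q *\<^sub>v (P *\<^sub>v v)"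
      using P Q that by (auto intro: assoc_mult_mat_vec)
    moreover have "1\<^sub>m n - P \<in> carrier_mat n n" "1\<^sub>m n - P - Q \<in> carrier_mat n n"
      "1\<^sub>m n - P - Q + P * Q \<in> carrier_mat n n" "P * Q \<in> carrier_mat n n" "Q * P \<in> carrier_mat n n"
      by (intro carrier_matI; simp)+
    ultimately show ?thesis
      unfolding K_def H_def using P Q that by (intro eq_vecI) (simp_all add: plus minus)
  qed
  interpret K: normal_pair n K K
  proof
    show "(K *\<^sub>v x) \<bullet>c y = x \<bullet>c (K *\<^sub>v y)" if "x \<in> carrier_vec n" "y \<in> carrier_vec n" for x y
      using that H_selfadjoint by (simp add: K)
  qed (use Kc in auto)
  have EK: "u \<in> E t \<longleftrightarrow> u \<in> carrier_vec n \<and> K *\<^sub>v u = t \<cdot>\<^sub>v u" for u t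
    using K by (auto simp: E_def)
  obtain F where "\<forall>e\<in>spectrum K. F e \<in> carrier_vec n \<and> K *\<^sub>v F e = e \<cdot>\<^sub>v F e"
    "x = vsum n F (spectrum K)"
    using K.spectral_decomposition[OF x] unfolding K.eigensum_def by blast
  then show ?thesis
    using card_finite_spectrum(1)[OF Kc] K.eigen_orthogonal
    by (intro that[of "spectrum K" F]) (auto simp: EK)
qed

text \<open>The values of the form and of its complement are the squared norms of \<open>P v\<close> and \<open>v - P v\<close>.\<close>
lemma projection_form:
  assumes v: "v \<in> carrier_vec n"
  shows "0 \<le> Re ((P *\<^sub>v v) \<bullet>c v)" "Re ((P *\<^sub>v v) \<bullet>c v) \<le> Re (v \<bullet>c v)" "Im ((P *\<^sub>v v) \<bullet>c v) = 0"
    "Re ((P *\<^sub>v v) \<bullet>c v) = Re (v \<bullet>c v) \<Longrightarrow> P *\<^sub>v v = v"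
    "Re ((P *\<^sub>v v) \<bullet>c v) = 0 \<Longrightarrow> P *\<^sub>v v = 0\<^sub>v n"
proof -
  have d: "dim_vec v = n" using v by simp
  have 1: "(P *\<^sub>v v) \<bullet>c v = (P *\<^sub>v v) \<bullet>c (P *\<^sub>v v)"
    using selfadjoint(1)[OF closed(1) v, of v] selfadjoint(1)[OF v closed(1), of v] d by simp
  have 2: "v \<bullet>c (P *\<^sub>v v) = (P *\<^sub>v v) \<bullet>c v"
    using selfadjoint(1)[OF v v] by simp
  have 3: "(v - P *\<^sub>v v) \<bullet>c (v - P *\<^sub>v v) = v \<bullet>c v - (P *\<^sub>v v) \<bullet>c v"
    using d by (simp add: 2 1[symmetric])
  show "0 \<le> Re ((P *\<^sub>v v) \<bullet>c v)" "Im ((P *\<^sub>v v) \<bullet>c v) = 0"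
    unfolding 1 using cip_self[of "P *\<^sub>v v"] by (metis, metis Im_complex_of_real)
  show "Re ((P *\<^sub>v v) \<bullet>c v) \<le> Re (v \<bullet>c v)"
    using cip_self(2)[of "v - P *\<^sub>v v"] 3 by simp
  show "P *\<^sub>v v = 0\<^sub>v n" if "Re ((P *\<^sub>v v) \<bullet>c v) = 0"
    using that 1 cip_self(1)[of "P *\<^sub>v v"] cip_self_eq_0[OF closed(1)] by simp
  show "P *\<^sub>v v = v" if "Re ((P *\<^sub>v v) \<bullet>c v) = Re (v \<bullet>c v)"
  proof -
    have c: "v - P *\<^sub>v v \<in> carrier_vec n" using v by simp
    have "v - P *\<^sub>v v = 0\<^sub>v n"
      using cip_self(1)[of "v - P *\<^sub>v v"] cip_self_eq_0[OF c] 3 that by simp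
    then have "(v - P *\<^sub>v v) $ i = 0" if "i < n" for i using that by simp
    then show ?thesis using d by (intro eq_vecI) auto
  qed
qed

text \<open>On the range of \<open>Q\<close> the operator \<open>H\<close> acts as the compression \<open>Q P Q\<close>, and on the kernel of \<open>Q\<close>
as \<open>1 - (1 - Q) P (1 - Q)\<close>. This determines the form of \<open>P\<close> on the two parts of an eigenspace.\<close>
lemma form_range:
  assumes "y \<in> E t" "Q *\<^sub>v y = y"
  shows "(P *\<^sub>v y) \<bullet>c y = t * (y \<bullet>c y)"
proof -
  have "(P *\<^sub>v y) \<bullet>c y = (Q *\<^sub>v (P *\<^sub>v y)) \<bullet>c y"
    using selfadjoint(2)[of "P *\<^sub>v y" y] assms E_carrier by simp
  then show ?thesis using QPQ[OF assms] E_dim[OF assms(1)] by simp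
qed

lemma form_kernel:
  assumes "z \<in> E t" "Q *\<^sub>v z = 0\<^sub>v n"
  shows "(P *\<^sub>v z) \<bullet>c z = (1 - t) * (z \<bullet>c z)"
proof -
  have z: "z \<in> carrier_vec n" and d: "dim_vec z = n" using assms E_carrier by auto
  have "(Q *\<^sub>v (P *\<^sub>v z)) \<bullet>c z = 0"
    using selfadjoint(2)[of "P *\<^sub>v z" z] z assms(2) d by simp
  moreover have "H z \<bullet>c z = t * (z \<bullet>c z)"
    using assms(1) by (simp add: E_def)
  ultimately show ?thesis
    unfolding H_def using d z assms(2) by (simp add: algebra_simps)
qed

text \<open>An eigenvalue of \<open>H\<close>, or its difference from \<open>1\<close>, is a Rayleigh quotient of the projection \<open>P\<close>.\<close>
lemma E_range:
  assumes x: "x \<in> E t" "x \<noteq> 0\<^sub>v n"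
  obtains r where "t = complex_of_real r" "0 \<le> r" "r \<le> 1"
proof -
  have quot: "\<exists>r. s = complex_of_real r \<and> 0 \<le> r \<and> r \<le> 1"
    if v: "v \<in> carrier_vec n" "v \<noteq> 0\<^sub>v n" and s: "(P *\<^sub>v v) \<bullet>c v = s * (v \<bullet>c v)" for s v
  proof -
    define q where "q = Re (v \<bullet>c v)"
    have q: "q > 0" "v \<bullet>c v = complex_of_real q"
      using cip_self_pos[OF v] cip_self(1)[of v] by (auto simp: q_def)
    then have "0 \<le> Re s * q" "Re s * q \<le> q" "Im s * q = 0"
      using projection_form(1-3)[OF v(1)] unfolding s q(2) by simp_all
    then show ?thesis using q(1)
      by (intro exI[of _ "Re s"]) (auto simp: zero_le_mult_iff complex_eq_iff)
  qed
  have c: "x \<in> carrier_vec n" "dim_vec x = n" using E_carrier x by auto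
  show ?thesis
  proof (cases "Q *\<^sub>v x = 0\<^sub>v n")
    case False
    then show ?thesis
      using quot[OF closed(2) False form_range[OF E_Q[OF x(1)]]] c that by auto
  next
    case True
    obtain r where "1 - t = complex_of_real r" "0 \<le> r" "r \<le> 1"
      using quot[OF c(1) x(2) form_kernel[OF x(1) True]] by blast
    then show ?thesis
      by (intro that[of "1 - r"]) (auto simp: algebra_simps complex_eq_iff)
  qed
qed

lemma range_kernel_orthogonal:
  assumes "y \<in> carrier_vec n" "z \<in> carrier_vec n" "Q *\<^sub>v y = y" "Q *\<^sub>v z = 0\<^sub>v n"
  shows "y \<bullet>c z = 0" "z \<bullet>c y = 0"
proof -
  have d: "dim_vec y = n" "dim_vec z = n" using assms by auto
  show "y \<bullet>c z = 0"
    using selfadjoint(2)[of y z] assms by simp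
  then show "z \<bullet>c y = 0"
    using cip_commute[of y z] d by simp
qed

text \<open>The part of \<open>P y\<close> that leaves the range of \<open>Q\<close>; normalised, it is the second basis vector of
the two-dimensional block generated by \<open>y\<close>. The factor \<open>r (1 - r)\<close> is \<open>c\<^sup>2 s\<^sup>2\<close>.\<close>
lemma residual_norm:
  assumes "y \<in> E (complex_of_real r)" "Q *\<^sub>v y = y"
  defines "w \<equiv> P *\<^sub>v y - complex_of_real r \<cdot>\<^sub>v y"
  shows "w \<bullet>c w = complex_of_real (r * (1 - r)) * (y \<bullet>c y)" "Q *\<^sub>v w = 0\<^sub>v n" "w \<in> E (complex_of_real r)"
    "(P *\<^sub>v y) \<bullet>c w = complex_of_real (r * (1 - r)) * (y \<bullet>c y)"
proof -
  have y: "y \<in> carrier_vec n" "dim_vec y = n" using assms E_carrier by auto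
  have f: "(P *\<^sub>v y) \<bullet>c y = of_real r * (y \<bullet>c y)" using form_range assms(1,2) by blast
  have f': "y \<bullet>c (P *\<^sub>v y) = of_real r * (y \<bullet>c y)" using f selfadjoint(1) y by simp
  have pp: "(P *\<^sub>v y) \<bullet>c (P *\<^sub>v y) = of_real r * (y \<bullet>c y)"
    using selfadjoint(1)[of "P *\<^sub>v y" y] f y by simp
  show "w \<bullet>c w = complex_of_real (r * (1 - r)) * (y \<bullet>c y)"
    "(P *\<^sub>v y) \<bullet>c w = complex_of_real (r * (1 - r)) * (y \<bullet>c y)"
    unfolding w_def using y by (simp_all add: f f' pp algebra_simps)
  show "Q *\<^sub>v w = 0\<^sub>v n"
    unfolding w_def using y QPQ[OF assms(1,2)] assms(2) by (simp add: minus_cancel_vec)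
  show "w \<in> E (complex_of_real r)"
    unfolding w_def using assms(1) by (intro E_diff E_P E_smult)
qed

lemma cross_bound:
  assumes y: "y \<in> E (complex_of_real r)" "Q *\<^sub>v y = y" and z: "z \<in> carrier_vec n" "Q *\<^sub>v z = 0\<^sub>v n"
  shows "(norm ((P *\<^sub>v y) \<bullet>c z))\<^sup>2 \<le> r * (1 - r) * Re (y \<bullet>c y) * Re (z \<bullet>c z)"
proof -
  define w where "w = P *\<^sub>v y - complex_of_real r \<cdot>\<^sub>v y"
  have yc: "y \<in> carrier_vec n" "dim_vec y = n" "dim_vec z = n" using y z E_carrier by auto
  have wz: "w \<bullet>c z = (P *\<^sub>v y) \<bullet>c z"
    unfolding w_def using yc range_kernel_orthogonal[OF yc(1) z(1) y(2) z(2)] by simp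
  have ww: "Re (w \<bullet>c w) = r * (1 - r) * Re (y \<bullet>c y)"
    unfolding w_def residual_norm(1)[OF y] by simp
  have "dim_vec w = dim_vec z" using yc by (simp add: w_def)
  then show ?thesis
    using cip_Cauchy_Schwarz[of w z] unfolding wz ww by simp
qed

text \<open>For \<open>t\<close> other than \<open>0\<close> and \<open>1\<close> no nonzero vector of \<open>E t\<close> lies in the kernel of both \<open>Q\<close> and \<open>Q P\<close>: on such a vector \<open>P\<close>
would be the scalar \<open>1 - t\<close>, which is not idempotent.\<close>
lemma E_meets_range:
  assumes x: "x \<in> E t" "x \<noteq> 0\<^sub>v n" and t: "t \<noteq> 0" "t \<noteq> 1"
  obtains u where "u \<in> E t" "Q *\<^sub>v u = u" "u \<bullet>c u = 1"
proof -
  have c: "x \<in> carrier_vec n" "dim_vec x = n" using E_carrier x by auto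
  have "\<exists>v. v \<in> E t \<and> Q *\<^sub>v v = v \<and> v \<noteq> 0\<^sub>v n"
  proof (cases "Q *\<^sub>v x = 0\<^sub>v n")
    case False
    then show ?thesis using E_Q[OF x(1)] c by (intro exI[of _ "Q *\<^sub>v x"]) simp
  next
    case True
    have "Q *\<^sub>v (P *\<^sub>v x) \<noteq> 0\<^sub>v n"
    proof
      assume 0: "Q *\<^sub>v (P *\<^sub>v x) = 0\<^sub>v n"
      have Px: "P *\<^sub>v x = (1 - t) \<cdot>\<^sub>v x"
        using E_index[OF x(1)] c 0 True by (intro eq_vecI) (auto simp: algebra_simps)
      then have "(1 - t) \<cdot>\<^sub>v x = (1 - t) \<cdot>\<^sub>v ((1 - t) \<cdot>\<^sub>v x)"
        using PP[OF c(2)] c by simp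
      moreover obtain i where i: "i < n" "x $ i \<noteq> 0"
        using x(2) c(2) by (metis eq_vecI index_zero_vec)
      ultimately have "(1 - t) * x $ i = (1 - t) * ((1 - t) * x $ i)"
        using c(2) by (metis index_smult_vec)
      then show False using i t by simp
    qed
    then show ?thesis using E_Q[OF E_P[OF x(1)]] by (intro exI[of _ "Q *\<^sub>v (P *\<^sub>v x)"]) simp
  qed
  then obtain v where v: "v \<in> E t" "Q *\<^sub>v v = v" "v \<noteq> 0\<^sub>v n" by blast
  have vc: "v \<in> carrier_vec n" "dim_vec v = n" using E_carrier v by auto
  define q where "q = Re (v \<bullet>c v)"
  have q: "q > 0" "v \<bullet>c v = complex_of_real q"
    using cip_self_pos[OF vc(1) v(3)] cip_self(1)[of v] by (auto simp: q_def)
  define k where "k = complex_of_real (1 / sqrt q)"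
  have "(k \<cdot>\<^sub>v v) \<bullet>c (k \<cdot>\<^sub>v v) = (k * cnj k) * (v \<bullet>c v)" by (simp add: mult_ac)
  also have "k * cnj k = 1 / complex_of_real q" using q(1) by (simp add: k_def flip: of_real_mult)
  finally have "(k \<cdot>\<^sub>v v) \<bullet>c (k \<cdot>\<^sub>v v) = 1" using q by simp
  then show ?thesis
    using v vc E_smult[OF v(1)] by (intro that[of "k \<cdot>\<^sub>v v"]) simp_all
qed

end

section \<open>The elliptical disk of a two-dimensional block\<close>

text \<open>The quadratic form of the two-by-two block with \<open>r = c\<^sup>2\<close>. The arguments \<open>y\<close> and \<open>z\<close> stand for the
squared moduli of the two coordinates and \<open>m\<close> for the cross term \<open>c s \<alpha> cnj \<beta>\<close>. Keeping \<open>m\<close> as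
a free argument lets the same expression describe the form on a whole eigenspace of \<open>H\<close>, where
\<open>m\<close> may be smaller.\<close>
definition block_value :: "complex \<Rightarrow> complex \<Rightarrow> complex \<Rightarrow> complex \<Rightarrow> real \<Rightarrow> complex \<Rightarrow> complex \<Rightarrow> complex \<Rightarrow> complex" where
  "block_value a1 a2 b1 b2 r y z m = b1 * (a1 * of_real r + a2 * of_real (1 - r)) * y
     + b2 * (a1 * of_real (1 - r) + a2 * of_real r) * z + (a1 - a2) * (b1 * m + b2 * cnj m)"

definition block_trace :: "complex \<Rightarrow> complex \<Rightarrow> complex \<Rightarrow> complex \<Rightarrow> real \<Rightarrow> complex" where
  "block_trace a1 a2 b1 b2 r = (a1 * b1 + a2 * b2) * of_real r + (a1 * b2 + a2 * b1) * of_real (1 - r)"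

lemma ell_c_block_trace:
  assumes "a1 \<noteq> a2" "b1 \<noteq> b2" and r: "0 < r" "r < 1"
  shows "ell_c a1 a2 b1 b2 (block_trace a1 a2 b1 b2 r) = sqrt r"
proof -
  have "(a1 * b1 + a2 * b2) - (a1 * b2 + a2 * b1) = (a1 - a2) * (b1 - b2)"
    by (simp add: algebra_simps)
  then have ne: "a1 * b1 + a2 * b2 \<noteq> a1 * b2 + a2 * b1"
    using assms(1,2) by auto
  have seg: "block_trace a1 a2 b1 b2 r \<in> open_segment (a1 * b1 + a2 * b2) (a1 * b2 + a2 * b1)"
    unfolding in_segment using r ne
    by (intro conjI exI[of _ "1 - r"]) (simp_all add: block_trace_def scaleR_conv_of_real mult.commute)
  show ?thesis
    unfolding ell_c_def
    by (rule the1_equality[OF ell_c_ex1[OF assms(1,2) seg]]) (use r in \<open>simp add: block_trace_def\<close>)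
qed

lemma ell_disk_block_trace:
  assumes ab: "a1 \<noteq> a2" "b1 \<noteq> b2" and r: "0 < r" "r < 1"
  shows "ell_disk a1 a2 b1 b2 (block_trace a1 a2 b1 b2 r) =
    {block_value a1 a2 b1 b2 r (\<alpha> * cnj \<alpha>) (\<beta> * cnj \<beta>) (of_real (sqrt (r * (1 - r))) * \<alpha> * cnj \<beta>)
      | \<alpha> \<beta>. \<alpha> * cnj \<alpha> + \<beta> * cnj \<beta> = 1}"
proof -
  define c s where "c = complex_of_real (sqrt r)" and "s = complex_of_real (sqrt (1 - r))"
  define C where "C = ell_C a1 a2 b1 b2 (block_trace a1 a2 b1 b2 r)"
  have two: "{0..<2} = {0, 1::nat}" by auto
  have cs: "c * s = of_real (sqrt (r * (1 - r)))" "c\<^sup>2 = of_real r" "s\<^sup>2 = of_real (1 - r)"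
    "cnj c = c" "cnj s = s"
    using r by (simp_all add: c_def s_def real_sqrt_mult flip: of_real_power)
  have C: "C = mat_of_rows_list 2
           [[a1 * c\<^sup>2 + a2 * s\<^sup>2, (a1 - a2) * c * s],
            [(a1 - a2) * c * s, a1 * s\<^sup>2 + a2 * c\<^sup>2]]
         * mat_of_rows_list 2 [[b1, 0], [0, b2]]"
    unfolding C_def ell_C_def Let_def ell_c_block_trace[OF assms] using r by (simp add: c_def s_def)
  have dC: "dim_row C = 2" "dim_col C = 2" by (simp_all add: C mat_of_rows_list_def)
  have Cx: "(C *\<^sub>v x) \<bullet>c x = block_value a1 a2 b1 b2 r (x $ 0 * cnj (x $ 0)) (x $ 1 * cnj (x $ 1))
      (of_real (sqrt (r * (1 - r))) * x $ 0 * cnj (x $ 1))" if x: "dim_vec x = 2" for x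
  proof -
    have entries: "C $$ (0,0) = (a1 * c\<^sup>2 + a2 * s\<^sup>2) * b1" "C $$ (0,1) = (a1 - a2) * c * s * b2"
      "C $$ (1,0) = (a1 - a2) * c * s * b1" "C $$ (1,1) = (a1 * s\<^sup>2 + a2 * c\<^sup>2) * b2"
      by (simp_all add: C mat_of_rows_list_def scalar_prod_def two)
    have "(C *\<^sub>v x) \<bullet>c x = block_value a1 a2 b1 b2 r (x $ 0 * cnj (x $ 0)) (x $ 1 * cnj (x $ 1))
      ((c * s) * x $ 0 * cnj (x $ 1))"
      using x dC by (simp add: scalar_prod_def two mat_vec_index lessThan_atLeast0 block_value_def entries cs(2-5) algebra_simps del: One_nat_def)
    then show ?thesis by (simp only: cs(1))
  qed
  show ?thesis
    unfolding ell_disk_def C_def[symmetric] numerical_range_def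
  proof (intro subset_antisym subsetI; elim CollectE exE conjE)
    fix w x assume w: "w = (C *\<^sub>v x) \<bullet>c x" "x \<in> carrier_vec (dim_col C)" "x \<bullet>c x = 1"
    have d: "dim_vec x = 2" using w(2) dC by simp
    have "x $ 0 * cnj (x $ 0) + x $ 1 * cnj (x $ 1) = 1"
      using w(3) d by (simp add: scalar_prod_def two)
    then show "w \<in> {block_value a1 a2 b1 b2 r (\<alpha> * cnj \<alpha>) (\<beta> * cnj \<beta>) (of_real (sqrt (r * (1 - r))) * \<alpha> * cnj \<beta>)
      | \<alpha> \<beta>. \<alpha> * cnj \<alpha> + \<beta> * cnj \<beta> = 1}"
      unfolding w(1) Cx[OF d] by blast
  next
    fix w \<alpha> \<beta> assume w: "w = block_value a1 a2 b1 b2 r (\<alpha> * cnj \<alpha>) (\<beta> * cnj \<beta>) (of_real (sqrt (r * (1 - r))) * \<alpha> * cnj \<beta>)"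
      "\<alpha> * cnj \<alpha> + \<beta> * cnj \<beta> = 1"
    define x where "x = Matrix.vec 2 (\<lambda>i. if i = 0 then \<alpha> else \<beta>)"
    have x: "dim_vec x = 2" "x $ 0 = \<alpha>" "x $ 1 = \<beta>" by (simp_all add: x_def)
    have "x \<bullet>c x = 1" using x w(2) by (simp add: scalar_prod_def two del: One_nat_def)
    moreover have "x \<in> carrier_vec (dim_col C)" using x dC by (auto intro: carrier_vecI)
    moreover have "w = (C *\<^sub>v x) \<bullet>c x" unfolding Cx[OF x(1)] x w(1) ..
    ultimately show "w \<in> {(C *\<^sub>v x) \<bullet>c x | x. x \<in> carrier_vec (dim_col C) \<and> x \<bullet>c x = 1}" by blast
  qed
qed

text \<open>Every point of the closed unit disk is the midpoint of a chord, perpendicular to the radius through it.\<close>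
lemma midpoint_of_unit_circle:
  assumes "norm (k :: complex) \<le> 1"
  obtains u v where "norm u = 1" "norm v = 1" "k = (u + v) / 2"
proof -
  define e where "e = (if k = 0 then 1 else k / norm k)"
  have e: "norm e = 1" "k = norm k * e" by (auto simp: e_def norm_divide)
  define h where "h = sqrt (1 - (norm k)\<^sup>2)"
  have "(norm k)\<^sup>2 \<le> 1" using assms by (simp add: power_le_one)
  then have h: "(norm k)\<^sup>2 + h\<^sup>2 = 1" by (simp add: h_def)
  show ?thesis
  proof (rule that)
    show "norm (e * Complex (norm k) h) = 1" "norm (e * Complex (norm k) (- h)) = 1"
      using e h by (simp_all add: norm_mult complex_norm)
    have "Complex (norm k) h + Complex (norm k) (- h) = 2 * of_real (norm k)"
      by (simp add: complex_eq_iff)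
    then have "(e * Complex (norm k) h + e * Complex (norm k) (- h)) / 2 = e * of_real (norm k)"
      by (simp flip: distrib_left)
    then show "k = (e * Complex (norm k) h + e * Complex (norm k) (- h)) / 2"
      using e(2) by (simp add: mult.commute)
  qed
qed

section \<open>Values in a scaled convex set\<close>

text \<open>Membership of \<open>(\<rho>, w)\<close> in the cone over \<open>K\<close>. Contributions of orthogonal components to the form
add up in this cone when \<open>K\<close> is convex, with the squared norms as weights.\<close>
definition scaled_in :: "complex set \<Rightarrow> real \<Rightarrow> complex \<Rightarrow> bool" where
  "scaled_in K \<rho> w \<longleftrightarrow> 0 \<le> \<rho> \<and> (if \<rho> = 0 then w = 0 else w / of_real \<rho> \<in> K)"

lemma scaled_in_add:
  assumes "convex K" "scaled_in K \<rho> v" "scaled_in K \<sigma> w"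
  shows "scaled_in K (\<rho> + \<sigma>) (v + w)"
proof (cases "\<rho> = 0 \<or> \<sigma> = 0")
  case True
  then show ?thesis using assms(2,3) by (auto simp: scaled_in_def)
next
  case False
  then have pos: "\<rho> > 0" "\<sigma> > 0" and K: "v / of_real \<rho> \<in> K" "w / of_real \<sigma> \<in> K"
    using assms(2,3) by (auto simp: scaled_in_def)
  have "(\<rho> / (\<rho> + \<sigma>)) *\<^sub>R (v / of_real \<rho>) + (\<sigma> / (\<rho> + \<sigma>)) *\<^sub>R (w / of_real \<sigma>) \<in> K"
    using pos by (intro convexD[OF assms(1)] K) (simp_all add: add_divide_distrib[symmetric])
  also have "(\<rho> / (\<rho> + \<sigma>)) *\<^sub>R (v / of_real \<rho>) + (\<sigma> / (\<rho> + \<sigma>)) *\<^sub>R (w / of_real \<sigma>) = (v + w) / of_real (\<rho> + \<sigma>)"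
    using pos by (simp add: scaleR_conv_of_real add_divide_distrib)
  finally show ?thesis using pos by (simp add: scaled_in_def)
qed

lemma scaled_in_sum:
  assumes "convex K" "finite T" "\<And>t. t \<in> T \<Longrightarrow> scaled_in K (\<rho> t) (w t)"
  shows "scaled_in K (sum \<rho> T) (sum w T)"
  using assms(2,3)
proof (induction T)
  case empty
  then show ?case by (simp add: scaled_in_def)
next
  case (insert t T)
  then show ?case using scaled_in_add[OF assms(1)] by simp
qed

lemma scaled_in_mult: "0 \<le> \<rho> \<Longrightarrow> (\<rho> \<noteq> 0 \<Longrightarrow> k \<in> K) \<Longrightarrow> scaled_in K \<rho> (k * of_real \<rho>)"
  by (auto simp: scaled_in_def)

section \<open>Products of two-valued normal matrices\<close>

locale two_valued_pair = two_projections +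
  fixes A B :: "complex mat" and a1 a2 b1 b2 :: complex
  assumes AB: "A \<in> carrier_mat n n" "B \<in> carrier_mat n n"
    and A_eq: "\<And>x. x \<in> carrier_vec n \<Longrightarrow> A *\<^sub>v x = a2 \<cdot>\<^sub>v x + (a1 - a2) \<cdot>\<^sub>v (P *\<^sub>v x)"
    and B_eq: "\<And>x. x \<in> carrier_vec n \<Longrightarrow> B *\<^sub>v x = b2 \<cdot>\<^sub>v x + (b1 - b2) \<cdot>\<^sub>v (Q *\<^sub>v x)"
    and distinct: "a1 \<noteq> a2" "b1 \<noteq> b2"
begin

lemma dims_AB [simp]: "dim_row A = n" "dim_col A = n" "dim_row B = n" "dim_col B = n"
  using AB by auto

lemma A_expand: "dim_vec x = n \<Longrightarrow> A *\<^sub>v x = a2 \<cdot>\<^sub>v x + (a1 - a2) \<cdot>\<^sub>v (P *\<^sub>v x)"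
  and B_expand: "dim_vec x = n \<Longrightarrow> B *\<^sub>v x = b2 \<cdot>\<^sub>v x + (b1 - b2) \<cdot>\<^sub>v (Q *\<^sub>v x)"
  by (auto intro: A_eq B_eq carrier_vecI)

definition M :: "complex Matrix.vec \<Rightarrow> complex Matrix.vec" where
  "M x = A *\<^sub>v (B *\<^sub>v x)"

lemma dim_M [simp]: "dim_vec (M x) = n"
  by (simp add: M_def)

lemma M_closed [simp]: "M x \<in> carrier_vec n"
  by (auto intro: carrier_vecI)

lemma M_eq: "x \<in> carrier_vec n \<Longrightarrow> (A * B) *\<^sub>v x = M x"
  using AB by (simp add: M_def)

lemma M_diff: "dim_vec x = n \<Longrightarrow> dim_vec y = n \<Longrightarrow> M (x - y) = M x - M y"
  and M_smult: "dim_vec x = n \<Longrightarrow> M (k \<cdot>\<^sub>v x) = k \<cdot>\<^sub>v M x"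
  by (simp_all add: M_def)

lemma E_M: "x \<in> E t \<Longrightarrow> M x \<in> E t"
proof -
  have A: "A *\<^sub>v v \<in> E t" if "v \<in> E t" for v
    unfolding A_eq[OF E_carrier[OF that]] using that by (intro E_add E_smult E_P)
  have B: "B *\<^sub>v v \<in> E t" if "v \<in> E t" for v
    unfolding B_eq[OF E_carrier[OF that]] using that by (intro E_add E_smult E_Q)
  show "x \<in> E t \<Longrightarrow> M x \<in> E t" unfolding M_def by (intro A B)
qed

lemma eigenvalue_in_spectrum:
  assumes "v \<in> carrier_vec n" "v \<noteq> 0\<^sub>v n" "M v = k \<cdot>\<^sub>v v"
  shows "k \<in> spectrum (A * B)"
  using assms M_eq unfolding spectrum_def eigenvalue_def eigenvector_def by auto

text \<open>On a block with trace \<open>\<gamma>\<close> and determinant \<open>\<delta>\<close> the Cayley--Hamilton theorem says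
\<open>M\<^sup>2 - \<gamma> M + \<delta> = 0\<close>. Here \<open>\<gamma>\<close> depends affinely on \<open>c\<^sup>2\<close>, and replacing \<open>c\<^sup>2\<close> by \<open>H\<close> gives an identity
on the whole space. It links the eigenvalues of \<open>M\<close> to those of \<open>H\<close> in both directions.\<close>
lemma quadratic_relation:
  assumes x: "x \<in> carrier_vec n" and i: "i < n"
  shows "M (M x) $ i = (a1 * b2 + a2 * b1) * M x $ i + (a1 - a2) * (b1 - b2) * H (M x) $ i - a1 * a2 * b1 * b2 * x $ i"
proof -
  have d: "dim_vec x = n" using x by simp
  show ?thesis
    unfolding M_def H_def using d i by (simp add: A_expand B_expand algebra_simps)
qed

lemma form_M:
  assumes x: "x \<in> E (complex_of_real r)"
  defines "y \<equiv> Q *\<^sub>v x" and "z \<equiv> x - Q *\<^sub>v x"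
  shows "M x \<bullet>c x = block_value a1 a2 b1 b2 r (y \<bullet>c y) (z \<bullet>c z) ((P *\<^sub>v y) \<bullet>c z)"
    and "x \<bullet>c x = y \<bullet>c y + z \<bullet>c z"
proof -
  have d: "dim_vec x = n" "dim_vec y = n" "dim_vec z = n" using E_dim[OF x] by (simp_all add: y_def z_def)
  have c: "y \<in> carrier_vec n" "z \<in> carrier_vec n" using d by (auto intro: carrier_vecI)
  have E: "y \<in> E (of_real r)" "z \<in> E (of_real r)"
    unfolding y_def z_def using x by (auto intro: E_Q E_diff)
  have Q: "Q *\<^sub>v y = y" "Q *\<^sub>v z = 0\<^sub>v n"
    unfolding y_def z_def using d by (simp_all add: minus_cancel_vec)
  have x': "x = y + z" unfolding y_def z_def using d by (intro eq_vecI) simp_all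
  have o: "y \<bullet>c z = 0" "z \<bullet>c y = 0" using range_kernel_orthogonal[OF c Q] by simp_all
  have B: "B *\<^sub>v x = b1 \<cdot>\<^sub>v y + b2 \<cdot>\<^sub>v z"
    unfolding x' using d by (intro eq_vecI) (simp_all add: B_expand Q algebra_simps)
  have yz: "(P *\<^sub>v z) \<bullet>c y = cnj ((P *\<^sub>v y) \<bullet>c z)"
    using selfadjoint(1)[OF c(2,1)] cip_commute[of "P *\<^sub>v y" z] d by simp
  show "M x \<bullet>c x = block_value a1 a2 b1 b2 r (y \<bullet>c y) (z \<bullet>c z) ((P *\<^sub>v y) \<bullet>c z)"
    unfolding M_def B unfolding x' block_value_def using d
    by (simp add: A_expand o yz form_range[OF E(1) Q(1)] form_kernel[OF E(2) Q(2)] algebra_simps)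
  show "x \<bullet>c x = y \<bullet>c y + z \<bullet>c z"
    unfolding x' using d by (simp add: o)
qed

text \<open>An eigenspace of \<open>H\<close> may contain many blocks, and \<open>x\<close> need not lie in a single one. Its cross
term \<open>m\<close> is still bounded by the value that it has in a block, so \<open>m\<close> is the midpoint of two
numbers of that maximal modulus. The form at \<open>x\<close> is then the midpoint of two points of the
elliptical disk, up to the factor \<open>x \<bullet>c x\<close>.\<close>
lemma block_value_in_disk:
  assumes x: "x \<in> E (complex_of_real r)" and r: "0 < r" "r < 1"
    and K: "convex K" "ell_disk a1 a2 b1 b2 (block_trace a1 a2 b1 b2 r) \<subseteq> K"
  shows "scaled_in K (Re (x \<bullet>c x)) (M x \<bullet>c x)"
proof -
  define y z where "y = Q *\<^sub>v x" and "z = x - Q *\<^sub>v x"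
  define m where "m = (P *\<^sub>v y) \<bullet>c z"
  define Y Z where "Y = Re (y \<bullet>c y)" and "Z = Re (z \<bullet>c z)"
  have YZ: "y \<bullet>c y = of_real Y" "z \<bullet>c z = of_real Z" "Y \<ge> 0" "Z \<ge> 0"
    unfolding Y_def Z_def by (rule cip_self)+
  have d: "dim_vec x = n" using E_dim[OF x] .
  have Mx: "M x \<bullet>c x = block_value a1 a2 b1 b2 r (of_real Y) (of_real Z) m" and xx: "Re (x \<bullet>c x) = Y + Z"
    using form_M[OF x] unfolding z_def[symmetric] unfolding y_def[symmetric] m_def[symmetric] YZ by simp_all
  define D where "D = sqrt (r * (1 - r)) * sqrt Y * sqrt Z"
  have D0: "D \<ge> 0" using YZ r by (simp add: D_def)
  have "(norm m)\<^sup>2 \<le> r * (1 - r) * Y * Z"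
    unfolding m_def Y_def Z_def
  proof (rule cross_bound)
    show "y \<in> E (of_real r)" unfolding y_def using x by (rule E_Q)
    show "Q *\<^sub>v y = y" "Q *\<^sub>v z = 0\<^sub>v n" "z \<in> carrier_vec n"
      unfolding y_def z_def using d by (auto simp: minus_cancel_vec intro: carrier_vecI)
  qed
  also have "\<dots> = D\<^sup>2" using YZ r by (simp add: D_def power_mult_distrib)
  finally have mD: "norm m \<le> D" using D0 by (rule power2_le_imp_le)
  have "norm (m / of_real D) \<le> 1"
    using mD D0 by (auto simp: norm_divide divide_le_eq_1)
  then obtain u v where uv: "norm u = 1" "norm v = 1" "m / of_real D = (u + v) / 2"
    by (rule midpoint_of_unit_circle)
  have m: "m = of_real D * ((u + v) / 2)"
    using mD uv(3)[symmetric] by (cases "D = 0") auto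
  have unit: "u * cnj u = 1" "v * cnj v = 1"
    using uv complex_norm_square[of u] complex_norm_square[of v] by simp_all
  show ?thesis
  proof (cases "Y + Z = 0")
    case True
    then have "Y = 0" "Z = 0" using YZ by linarith+
    then have "m = 0" using mD by (simp add: D_def)
    then show ?thesis using \<open>Y = 0\<close> \<open>Z = 0\<close> by (simp add: scaled_in_def Mx xx block_value_def)
  next
    case False
    then have pos: "Y + Z > 0" using YZ by linarith
    define k where "k = sqrt (Y + Z)"
    have k: "k > 0" "k * k = Y + Z" using pos by (simp_all add: k_def)
    define \<alpha> where "\<alpha> u = complex_of_real (sqrt Y / k) * u" for u
    define \<beta> where "\<beta> = complex_of_real (sqrt Z / k)"
    have \<alpha>: "\<alpha> u * cnj (\<alpha> u) = of_real (Y / (Y + Z))" if "u * cnj u = 1" for u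
    proof -
      have "\<alpha> u * cnj (\<alpha> u) = of_real ((sqrt Y / k) * (sqrt Y / k)) * (u * cnj u)"
        unfolding \<alpha>_def by (simp only: complex_cnj_mult complex_cnj_complex_of_real of_real_mult mult_ac)
      also have "(sqrt Y / k) * (sqrt Y / k) = Y / (Y + Z)"
        using YZ by (simp add: k(2))
      finally show ?thesis using that by simp
    qed
    have \<beta>: "\<beta> * cnj \<beta> = of_real (Z / (Y + Z))"
    proof -
      have "\<beta> * cnj \<beta> = of_real ((sqrt Z / k) * (sqrt Z / k))"
        unfolding \<beta>_def by (simp only: complex_cnj_complex_of_real of_real_mult)
      also have "(sqrt Z / k) * (sqrt Z / k) = Z / (Y + Z)"
        using YZ by (simp add: k(2))
      finally show ?thesis .
    qed
    have \<alpha>\<beta>: "of_real (sqrt (r * (1 - r))) * \<alpha> u * cnj \<beta> = of_real (D / (Y + Z)) * u" for u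
    proof -
      have "of_real (sqrt (r * (1 - r))) * \<alpha> u * cnj \<beta> = of_real (D / (k * k)) * u"
        by (simp add: \<alpha>_def \<beta>_def D_def)
      then show ?thesis by (simp only: k(2))
    qed
    have pt: "block_value a1 a2 b1 b2 r (of_real (Y / (Y + Z))) (of_real (Z / (Y + Z))) (of_real (D / (Y + Z)) * u) \<in> K"
      if u: "u * cnj u = 1" for u
    proof (rule subsetD[OF K(2)])
      have "\<alpha> u * cnj (\<alpha> u) + \<beta> * cnj \<beta> = of_real (Y / (Y + Z) + Z / (Y + Z))"
        unfolding \<alpha>[OF u] \<beta> by simp
      also have "Y / (Y + Z) + Z / (Y + Z) = 1" using pos by (simp flip: add_divide_distrib)
      finally have "\<alpha> u * cnj (\<alpha> u) + \<beta> * cnj \<beta> = 1" by simp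
      then show "block_value a1 a2 b1 b2 r (of_real (Y / (Y + Z))) (of_real (Z / (Y + Z))) (of_real (D / (Y + Z)) * u)
          \<in> ell_disk a1 a2 b1 b2 (block_trace a1 a2 b1 b2 r)"
        unfolding ell_disk_block_trace[OF distinct r] \<alpha>[OF u, symmetric] \<beta>[symmetric] \<alpha>\<beta>[symmetric]
        by blast
    qed
    let ?v = "\<lambda>u. block_value a1 a2 b1 b2 r (of_real (Y / (Y + Z))) (of_real (Z / (Y + Z))) (of_real (D / (Y + Z)) * u)"
    have "(1/2) *\<^sub>R ?v u + (1/2) *\<^sub>R ?v v \<in> K"
      by (intro convexD[OF K(1)] pt unit) simp_all
    also have "(1/2) *\<^sub>R ?v u + (1/2) *\<^sub>R ?v v = (M x \<bullet>c x) / of_real (Y + Z)"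
      unfolding Mx m block_value_def scaleR_conv_of_real using pos by (simp add: field_simps flip: of_real_add)
    finally show ?thesis using pos by (simp add: scaled_in_def xx)
  qed
qed

text \<open>For \<open>r = 0\<close> and \<open>r = 1\<close> the bound on the cross term is \<open>0\<close>, and the parts of \<open>x\<close> in the range and
in the kernel of \<open>Q\<close> are joint eigenvectors of \<open>P\<close> and \<open>Q\<close>.\<close>
lemma value_at_endpoint:
  assumes x: "x \<in> E (complex_of_real r)" and r: "r = 0 \<or> r = 1"
    and K: "convex K" "spectrum (A * B) \<inter> {a1 * b1, a1 * b2, a2 * b1, a2 * b2} \<subseteq> K"
  shows "scaled_in K (Re (x \<bullet>c x)) (M x \<bullet>c x)"
proof -
  define y z where "y = Q *\<^sub>v x" and "z = x - Q *\<^sub>v x"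
  define Y Z where "Y = Re (y \<bullet>c y)" and "Z = Re (z \<bullet>c z)"
  have YZ: "y \<bullet>c y = of_real Y" "z \<bullet>c z = of_real Z" "Y \<ge> 0" "Z \<ge> 0"
    unfolding Y_def Z_def by (rule cip_self)+
  have d: "dim_vec x = n" "dim_vec y = n" "dim_vec z = n" using E_dim[OF x] by (simp_all add: y_def z_def)
  have c: "y \<in> carrier_vec n" "z \<in> carrier_vec n" using d by (auto intro: carrier_vecI)
  have E: "y \<in> E (of_real r)" "z \<in> E (of_real r)"
    unfolding y_def z_def using x by (auto intro: E_Q E_diff)
  have Q: "Q *\<^sub>v y = y" "Q *\<^sub>v z = 0\<^sub>v n"
    unfolding y_def z_def using d by (simp_all add: minus_cancel_vec)
  have "norm ((P *\<^sub>v y) \<bullet>c z) \<le> 0"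
    using cross_bound[OF E(1) Q(1) c(2) Q(2)] r by auto
  then have m: "(P *\<^sub>v y) \<bullet>c z = 0" by simp
  have Mx: "M x \<bullet>c x = block_value a1 a2 b1 b2 r (of_real Y) (of_real Z) 0" and xx: "Re (x \<bullet>c x) = Y + Z"
    using form_M[OF x] unfolding z_def[symmetric] unfolding y_def[symmetric] m YZ by simp_all
  have fy: "(P *\<^sub>v y) \<bullet>c y = of_real (r * Y)" using form_range[OF E(1) Q(1)] YZ by simp
  have fz: "(P *\<^sub>v z) \<bullet>c z = of_real ((1 - r) * Z)" using form_kernel[OF E(2) Q(2)] YZ by simp
  have y0: "y \<noteq> 0\<^sub>v n" if "Y \<noteq> 0" using that by (auto simp: Y_def)
  have z0: "z \<noteq> 0\<^sub>v n" if "Z \<noteq> 0" using that by (auto simp: Z_def)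
  have inK: "k \<in> K" if "v \<in> carrier_vec n" "v \<noteq> 0\<^sub>v n" "M v = k \<cdot>\<^sub>v v"
    "k \<in> {a1 * b1, a1 * b2, a2 * b1, a2 * b2}" for v k
    using that eigenvalue_in_spectrum K(2) by blast
  from r show ?thesis
  proof
    assume r: "r = 0"
    have P: "P *\<^sub>v y = 0\<^sub>v n" "P *\<^sub>v z = z"
      using projection_form(5)[OF c(1)] projection_form(4)[OF c(2)] fy fz r by (simp_all add: Z_def)
    have "M y = (a2 * b1) \<cdot>\<^sub>v y" "M z = (a1 * b2) \<cdot>\<^sub>v z"
      unfolding M_def using d by (intro eq_vecI; simp add: A_expand B_expand P Q algebra_simps)+
    then have "scaled_in K Y ((a2 * b1) * of_real Y)" "scaled_in K Z ((a1 * b2) * of_real Z)"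
      using inK[OF c(1) y0] inK[OF c(2) z0] YZ by (auto intro!: scaled_in_mult)
    then show ?thesis
      using scaled_in_add[OF K(1)] r by (auto simp: Mx xx block_value_def mult_ac)
  next
    assume r: "r = 1"
    have P: "P *\<^sub>v y = y" "P *\<^sub>v z = 0\<^sub>v n"
      using projection_form(4)[OF c(1)] projection_form(5)[OF c(2)] fy fz r by (simp_all add: Y_def)
    have "M y = (a1 * b1) \<cdot>\<^sub>v y" "M z = (a2 * b2) \<cdot>\<^sub>v z"
      unfolding M_def using d by (intro eq_vecI; simp add: A_expand B_expand P Q algebra_simps)+
    then have "scaled_in K Y ((a1 * b1) * of_real Y)" "scaled_in K Z ((a2 * b2) * of_real Z)"
      using inK[OF c(1) y0] inK[OF c(2) z0] YZ by (auto intro!: scaled_in_mult)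
    then show ?thesis
      using scaled_in_add[OF K(1)] r by (auto simp: Mx xx block_value_def mult_ac)
  qed
qed

text \<open>A unit vector \<open>u\<close> of the eigenspace in the range of \<open>Q\<close> and the normalised residual \<open>f\<close> of \<open>P u\<close>
are an orthonormal basis of one block.\<close>
lemma disk_subset_numerical_range:
  assumes x: "x \<in> E (complex_of_real r)" "x \<noteq> 0\<^sub>v n" and r: "0 < r" "r < 1"
  shows "ell_disk a1 a2 b1 b2 (block_trace a1 a2 b1 b2 r) \<subseteq> numerical_range (A * B)"
proof
  fix k assume "k \<in> ell_disk a1 a2 b1 b2 (block_trace a1 a2 b1 b2 r)"
  then obtain \<alpha> \<beta> where \<alpha>\<beta>: "\<alpha> * cnj \<alpha> + \<beta> * cnj \<beta> = 1"
    and k: "k = block_value a1 a2 b1 b2 r (\<alpha> * cnj \<alpha>) (\<beta> * cnj \<beta>) (of_real (sqrt (r * (1 - r))) * \<alpha> * cnj \<beta>)"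
    unfolding ell_disk_block_trace[OF distinct r] by blast
  obtain u where u: "u \<in> E (complex_of_real r)" "Q *\<^sub>v u = u" "u \<bullet>c u = 1"
    using E_meets_range[OF x] r by auto
  define \<sigma> where "\<sigma> = sqrt (r * (1 - r))"
  have \<sigma>: "\<sigma> > 0" "\<sigma> * \<sigma> = r * (1 - r)" using r by (simp_all add: \<sigma>_def)
  define w where "w = P *\<^sub>v u - complex_of_real r \<cdot>\<^sub>v u"
  note res = residual_norm[OF u(1,2), folded w_def]
  define f where "f = complex_of_real (1 / \<sigma>) \<cdot>\<^sub>v w"
  have d: "dim_vec u = n" "dim_vec w = n" "dim_vec f = n"
    using E_dim[OF u(1)] by (simp_all add: w_def f_def)
  have "f \<bullet>c f = of_real (1 / (\<sigma> * \<sigma>)) * (w \<bullet>c w)"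
    by (simp add: f_def)
  then have ff: "f \<bullet>c f = 1"
    unfolding res(1) u(3) \<sigma>(2) using r by (simp flip: of_real_mult of_real_diff)
  have "(P *\<^sub>v u) \<bullet>c f = of_real (1 / \<sigma>) * ((P *\<^sub>v u) \<bullet>c w)"
    using d by (simp add: f_def)
  also have "\<dots> = of_real (1 / \<sigma> * (\<sigma> * \<sigma>))"
    unfolding res(4) u(3) \<sigma>(2) by simp
  finally have Puf: "(P *\<^sub>v u) \<bullet>c f = of_real \<sigma>" using \<sigma>(1) by simp
  have Qf: "Q *\<^sub>v f = 0\<^sub>v n"
    unfolding f_def using d by (intro eq_vecI) (simp_all add: res(2))
  define v where "v = \<alpha> \<cdot>\<^sub>v u + \<beta> \<cdot>\<^sub>v f"
  have v: "v \<in> E (complex_of_real r)"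
    unfolding v_def f_def using u(1) res(3) by (intro E_add E_smult)
  have Qv: "Q *\<^sub>v v = \<alpha> \<cdot>\<^sub>v u"
    unfolding v_def using d by (intro eq_vecI) (simp_all add: u(2) Qf)
  have vQ: "v - Q *\<^sub>v v = \<beta> \<cdot>\<^sub>v f"
    unfolding Qv unfolding v_def using d by (intro eq_vecI) simp_all
  have 1: "(\<alpha> \<cdot>\<^sub>v u) \<bullet>c (\<alpha> \<cdot>\<^sub>v u) = \<alpha> * cnj \<alpha>" "(\<beta> \<cdot>\<^sub>v f) \<bullet>c (\<beta> \<cdot>\<^sub>v f) = \<beta> * cnj \<beta>"
    using u(3) ff by simp_all
  have 2: "(P *\<^sub>v (\<alpha> \<cdot>\<^sub>v u)) \<bullet>c (\<beta> \<cdot>\<^sub>v f) = of_real \<sigma> * \<alpha> * cnj \<beta>"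
    using d Puf by simp
  have "M v \<bullet>c v = k" "v \<bullet>c v = 1"
    using form_M[OF v] unfolding vQ unfolding Qv 1 2 \<alpha>\<beta> unfolding k \<sigma>_def by simp_all
  moreover have "v \<in> carrier_vec n" using E_carrier[OF v] .
  ultimately show "k \<in> numerical_range (A * B)"
    unfolding numerical_range_def using M_eq by (intro CollectI exI[of _ v]) auto
qed

text \<open>If \<open>M\<close> acts as a scalar, the off-diagonal entries \<open>b1 (a1 - a2) c s\<close> and \<open>b2 (a1 - a2) c s\<close> of
each block vanish, so that \<open>b1 = b2 = 0\<close>.\<close>
lemma M_not_scalar_on_E:
  assumes x: "x \<in> E (complex_of_real r)" "x \<noteq> 0\<^sub>v n" and r: "0 < r" "r < 1"
  obtains v where "v \<in> E (complex_of_real r)" "M v \<noteq> k \<cdot>\<^sub>v v"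
proof (rule ccontr)
  assume "\<not> thesis"
  then have scalar: "M v = k \<cdot>\<^sub>v v" if "v \<in> E (complex_of_real r)" for v
    using that \<open>\<And>v. v \<in> E (complex_of_real r) \<Longrightarrow> M v \<noteq> k \<cdot>\<^sub>v v \<Longrightarrow> thesis\<close> by blast
  obtain u where u: "u \<in> E (complex_of_real r)" "Q *\<^sub>v u = u" "u \<bullet>c u = 1"
    using E_meets_range[OF x] r by auto
  have c: "u \<in> carrier_vec n" "dim_vec u = n" using E_carrier u by auto
  define w where "w = P *\<^sub>v u - complex_of_real r \<cdot>\<^sub>v u"
  note res = residual_norm[OF u(1,2), folded w_def]
  have wc: "w \<in> carrier_vec n" "dim_vec w = n" using c by (auto simp: w_def intro: carrier_vecI)
  have ww: "w \<bullet>c w \<noteq> 0" "(P *\<^sub>v u) \<bullet>c w \<noteq> 0" unfolding res u(3) using r by simp_all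
  have uw: "u \<bullet>c w = 0" using range_kernel_orthogonal(1)[OF c(1) wc(1) u(2) res(2)] .
  have "M u \<bullet>c w = b1 * (a1 - a2) * ((P *\<^sub>v u) \<bullet>c w)"
    unfolding M_def using c wc uw by (simp add: A_expand B_expand u(2) algebra_simps)
  then have b1: "b1 = 0"
    using scalar[OF u(1)] ww c wc uw distinct by simp
  have Pwu: "(P *\<^sub>v w) \<bullet>c u = cnj ((P *\<^sub>v u) \<bullet>c w)"
    using selfadjoint(1)[OF wc(1) c(1)] cip_commute[of "P *\<^sub>v u" w] wc by simp
  have wu: "w \<bullet>c u = 0" using cip_commute[of u w] c wc uw by simp
  have "M w \<bullet>c u = b2 * (a1 - a2) * ((P *\<^sub>v w) \<bullet>c u)"
    unfolding M_def using c wc wu by (simp add: A_expand B_expand res(2) algebra_simps)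
  then have "b2 = 0"
    using scalar[OF res(3)] ww c wc wu distinct by (simp add: Pwu)
  then show False using b1 distinct by simp
qed

lemma block_quadratic:
  assumes v: "v \<in> E (complex_of_real r)"
  shows "M (M v) = block_trace a1 a2 b1 b2 r \<cdot>\<^sub>v M v - (a1 * a2 * b1 * b2) \<cdot>\<^sub>v v"
proof (rule eq_vecI)
  have d: "dim_vec v = n" using E_dim[OF v] .
  fix i assume "i < dim_vec (block_trace a1 a2 b1 b2 r \<cdot>\<^sub>v M v - (a1 * a2 * b1 * b2) \<cdot>\<^sub>v v)"
  then have i: "i < n" using d by simp
  have "H (M v) $ i = of_real r * M v $ i"
    using E_M[OF v] i by (simp add: E_def)
  then show "M (M v) $ i = (block_trace a1 a2 b1 b2 r \<cdot>\<^sub>v M v - (a1 * a2 * b1 * b2) \<cdot>\<^sub>v v) $ i"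
    using quadratic_relation[OF E_carrier[OF v] i] i d by (simp add: block_trace_def algebra_simps)
qed (use E_dim[OF v] in simp)

text \<open>Let \<open>l\<close>, \<open>l'\<close> be the roots of the characteristic polynomial of the block. Since \<open>M\<close> is not the
scalar \<open>l'\<close> on the eigenspace, \<open>M - l'\<close> has a nonzero value there, and this value is an
eigenvector for \<open>l\<close>. A nonzero \<open>l\<close> is needed for the quotient \<open>\<delta> / l\<close>. Both roots are \<open>0\<close> only
if the block is nilpotent, and then the condition on the kernels would make it zero.\<close>
lemma block_eigenvalue:
  assumes x: "x \<in> E (complex_of_real r)" "x \<noteq> 0\<^sub>v n" and r: "0 < r" "r < 1"
    and ker: "\<And>v. v \<in> carrier_vec n \<Longrightarrow> M (M v) = 0\<^sub>v n \<Longrightarrow> M v = 0\<^sub>v n"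
  obtains l where "l \<in> spectrum (A * B)" "l \<notin> {a1 * b1, a1 * b2, a2 * b1, a2 * b2}"
    "l + (a1 * a2 * b1 * b2) / l = block_trace a1 a2 b1 b2 r"
proof -
  define g where "g = block_trace a1 a2 b1 b2 r"
  define D where "D = a1 * a2 * b1 * b2"
  have quad: "M (M v) = g \<cdot>\<^sub>v M v - D \<cdot>\<^sub>v v" if "v \<in> E (complex_of_real r)" for v
    using block_quadratic[OF that] by (simp add: g_def D_def)
  have "g \<noteq> 0 \<or> D \<noteq> 0"
  proof (rule ccontr)
    assume 0: "\<not> (g \<noteq> 0 \<or> D \<noteq> 0)"
    obtain v where v: "v \<in> E (complex_of_real r)" "M v \<noteq> 0 \<cdot>\<^sub>v v"
      using M_not_scalar_on_E[OF x r] by blast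
    have d: "dim_vec v = n" using E_dim v by blast
    have "M (M v) = 0\<^sub>v n" unfolding quad[OF v(1)] using 0 d by (intro eq_vecI) simp_all
    then have "M v = 0\<^sub>v n" using ker E_carrier v by blast
    then show False using v(2) d by (auto intro!: eq_vecI)
  qed
  moreover define s where "s = csqrt (g\<^sup>2 - 4 * D)"
  have "((g + s) / 2) * ((g - s) / 2) = D"
    using power2_csqrt[of "g\<^sup>2 - 4 * D"] by (simp add: s_def algebra_simps power2_eq_square)
  moreover have "((g + s) / 2) + ((g - s) / 2) = g"
    by (simp flip: add_divide_distrib)
  ultimately obtain l l' where l: "l \<noteq> 0" "l * l' = D" "l + l' = g"
    by (metis add.commute add_cancel_right_left mult.commute mult_zero_left)
  obtain v where v: "v \<in> E (complex_of_real r)" "M v \<noteq> l' \<cdot>\<^sub>v v"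
    using M_not_scalar_on_E[OF x r] by blast
  have d: "dim_vec v = n" using E_dim v by blast
  define e where "e = M v - l' \<cdot>\<^sub>v v"
  have e: "e \<in> carrier_vec n" using d by (auto simp: e_def intro: carrier_vecI)
  have "e \<noteq> 0\<^sub>v n"
  proof
    assume e0: "e = 0\<^sub>v n"
    have "M v = l' \<cdot>\<^sub>v v"
    proof (rule eq_vecI)
      fix i assume "i < dim_vec (l' \<cdot>\<^sub>v v)"
      then have i: "i < n" using d by simp
      then have "e $ i = 0" using e0 by simp
      then show "M v $ i = (l' \<cdot>\<^sub>v v) $ i" using i d by (simp add: e_def)
    qed (use d in simp)
    then show False using v by simp
  qed
  moreover have "M e = l \<cdot>\<^sub>v e"
  proof (rule eq_vecI)
    fix i assume "i < dim_vec (l \<cdot>\<^sub>v e)"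
    then have i: "i < n" using e by simp
    show "M e $ i = (l \<cdot>\<^sub>v e) $ i"
      unfolding e_def using d i l(2,3)[symmetric] by (simp add: M_diff M_smult quad[OF v(1)] algebra_simps)
  qed (use e in simp)
  ultimately have "l \<in> spectrum (A * B)"
    using eigenvalue_in_spectrum e by blast
  moreover have tr: "l + D / l = g" using l by auto
  moreover have "l \<notin> {a1 * b1, a1 * b2, a2 * b1, a2 * b2}"
  proof
    have ne: "(a1 - a2) * (b1 - b2) \<noteq> 0" "complex_of_real r \<noteq> 0" "1 - complex_of_real r \<noteq> 0"
      using distinct r by auto
    have g1: "g - (a1 * b1 + a2 * b2) = - ((a1 - a2) * (b1 - b2) * (1 - complex_of_real r))"
      and g2: "g - (a1 * b2 + a2 * b1) = (a1 - a2) * (b1 - b2) * complex_of_real r"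
      unfolding g_def block_trace_def by (simp_all add: algebra_simps)
    assume "l \<in> {a1 * b1, a1 * b2, a2 * b1, a2 * b2}"
    then have "D / l = (a1 * b1 + a2 * b2) - l \<or> D / l = (a1 * b2 + a2 * b1) - l"
      using l(1) unfolding D_def by auto
    then have "g = a1 * b1 + a2 * b2 \<or> g = a1 * b2 + a2 * b1"
      using tr by auto
    then show False using g1 g2 ne by auto
  qed
  ultimately show ?thesis using that unfolding g_def D_def by blast
qed

text \<open>The quadratic relation, read at an eigenvector of \<open>M\<close>, makes it an eigenvector of \<open>H\<close>. The
eigenvalues \<open>0\<close> and \<open>1\<close> of \<open>H\<close> are impossible, as the characteristic polynomial then has the
products \<open>a\<^sub>i b\<^sub>j\<close> as its roots.\<close>
lemma eigenvalue_block:
  assumes l: "l \<in> spectrum (A * B)" "l \<notin> {a1 * b1, a1 * b2, a2 * b1, a2 * b2}" and l0: "l \<noteq> 0"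
  obtains r x where "0 < r" "r < 1" "x \<in> E (complex_of_real r)" "x \<noteq> 0\<^sub>v n"
    "l + (a1 * a2 * b1 * b2) / l = block_trace a1 a2 b1 b2 r"
proof -
  obtain x where x: "x \<in> carrier_vec n" "x \<noteq> 0\<^sub>v n" "M x = l \<cdot>\<^sub>v x"
    using l(1) M_eq unfolding spectrum_def eigenvalue_def eigenvector_def by auto
  have d: "dim_vec x = n" using x by simp
  define e where "e = (a1 - a2) * (b1 - b2)"
  have e0: "e \<noteq> 0" using distinct by (simp add: e_def)
  define D where "D = a1 * a2 * b1 * b2"
  define t where "t = (l + D / l - (a1 * b2 + a2 * b1)) / e"
  have MMx: "M (M x) = l \<cdot>\<^sub>v (l \<cdot>\<^sub>v x)" using x d by (simp add: M_smult)
  have Hx: "H x = t \<cdot>\<^sub>v x"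
  proof (rule eq_vecI)
    fix i assume "i < dim_vec (t \<cdot>\<^sub>v x)"
    then have i: "i < n" using d by simp
    have "H (M x) $ i = l * H x $ i" unfolding x(3) using i d by (simp add: H_smult)
    then have "l * (l * x $ i) = (a1 * b2 + a2 * b1) * (l * x $ i) + e * (l * H x $ i) - D * x $ i"
      using quadratic_relation[OF x(1) i] i d unfolding MMx by (simp add: x(3) e_def D_def)
    then have "(l * e) * H x $ i = (l * e) * (t * x $ i)"
      using l0 e0 by (simp add: t_def field_simps)
    then show "H x $ i = (t \<cdot>\<^sub>v x) $ i" using l0 e0 i d by simp
  qed (use d in simp)
  then have xE: "x \<in> E t" using x by (simp add: E_def)
  obtain r where r: "t = complex_of_real r" "0 \<le> r" "r \<le> 1"
    using E_range[OF xE x(2)] by blast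
  have tr: "l + D / l = (a1 * b2 + a2 * b1) + e * of_real r"
    using e0 r(1) by (simp add: t_def field_simps)
  then have quad: "l * l + D = l * ((a1 * b2 + a2 * b1) + e * of_real r)"
    using l0 by (simp add: field_simps)
  have "r \<noteq> 0"
  proof
    assume "r = 0"
    then have "(l - a1 * b2) * (l - a2 * b1) = 0" using quad by (simp add: D_def algebra_simps)
    then show False using l(2) by auto
  qed
  moreover have "r \<noteq> 1"
  proof
    assume "r = 1"
    then have "(l - a1 * b1) * (l - a2 * b2) = 0" using quad by (simp add: D_def e_def algebra_simps)
    then show False using l(2) by auto
  qed
  moreover have "l + D / l = block_trace a1 a2 b1 b2 r"
    unfolding tr block_trace_def e_def by (simp add: algebra_simps)
  ultimately show ?thesis
    using that[of r x] r xE x(2) unfolding D_def by simp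
qed

text \<open>For the inclusion of the hull, convexity reduces the claim to single disks and eigenvalues. For
the converse, a unit vector is split along the eigenspaces of \<open>H\<close>; both the squared norm and the
form are sums over the components, and each component contributes a point of the hull weighted
by its squared norm.\<close>
theorem numerical_range_eq:
  assumes S: "S = spectrum (A * B) \<inter> {a1 * b1, a1 * b2, a2 * b1, a2 * b2}"
    and zero: "0 \<in> spectrum (A * B) \<Longrightarrow> a1 * a2 * b1 * b2 = 0"
    and ker: "\<And>v. v \<in> carrier_vec n \<Longrightarrow> M (M v) = 0\<^sub>v n \<Longrightarrow> M v = 0\<^sub>v n"
  shows "numerical_range (A * B) =
    convex hull ((\<Union>l \<in> spectrum (A * B) - S. ell_disk a1 a2 b1 b2 (l + (a1 * a2 * b1 * b2) / l)) \<union> S)"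
    (is "_ = convex hull (?U \<union> S)")
proof
  show "convex hull (?U \<union> S) \<subseteq> numerical_range (A * B)"
  proof (rule hull_minimal)
    show "convex (numerical_range (A * B))"
      using AB by (intro convex_numerical_range[of _ n]) simp
    show "?U \<union> S \<subseteq> numerical_range (A * B)"
    proof (intro Un_least UN_least)
      fix l assume l: "l \<in> spectrum (A * B) - S"
      then have l': "l \<in> spectrum (A * B)" "l \<notin> {a1 * b1, a1 * b2, a2 * b1, a2 * b2}"
        by (auto simp: S)
      have "l \<noteq> 0" using l' zero by auto
      then obtain r x where "0 < r" "r < 1" "x \<in> E (complex_of_real r)" "x \<noteq> 0\<^sub>v n"
        "l + (a1 * a2 * b1 * b2) / l = block_trace a1 a2 b1 b2 r"
        using eigenvalue_block[OF l'] by blast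
      then show "ell_disk a1 a2 b1 b2 (l + (a1 * a2 * b1 * b2) / l) \<subseteq> numerical_range (A * B)"
        using disk_subset_numerical_range by simp
    next
      show "S \<subseteq> numerical_range (A * B)"
      proof
        fix l assume "l \<in> S"
        then obtain x where x: "x \<in> carrier_vec n" "x \<noteq> 0\<^sub>v n" "(A * B) *\<^sub>v x = l \<cdot>\<^sub>v x"
          unfolding S spectrum_def eigenvalue_def eigenvector_def by auto
        have "x \<bullet>c x \<noteq> 0" using cip_self_eq_0[OF x(1)] x(2) by simp
        moreover have "((A * B) *\<^sub>v x) \<bullet>c x = l * (x \<bullet>c x)" unfolding x(3) by simp
        moreover have "A * B \<in> carrier_mat n n" using AB by simp
        ultimately show "l \<in> numerical_range (A * B)"
          using numerical_range_quotient[of "A * B" n x] x by simp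
      qed
    qed
  qed
next
  show "numerical_range (A * B) \<subseteq> convex hull (?U \<union> S)"
  proof
    let ?K = "convex hull (?U \<union> S)"
    have K: "convex ?K" by (rule convex_convex_hull)
    fix w assume "w \<in> numerical_range (A * B)"
    then obtain x where x: "x \<in> carrier_vec n" "x \<bullet>c x = 1" and w: "w = M x \<bullet>c x"
      unfolding numerical_range_def using M_eq by auto
    obtain T F where T: "finite T" and F: "\<And>t. t \<in> T \<Longrightarrow> F t \<in> E t" and xF: "x = vsum n F T"
      and orth: "\<And>s t u v. s \<in> T \<Longrightarrow> t \<in> T \<Longrightarrow> s \<noteq> t \<Longrightarrow> u \<in> E s \<Longrightarrow> v \<in> E t \<Longrightarrow> u \<bullet>c v = 0"
      using E_orthogonal_spectral[OF x(1)] by metis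
    have Fc: "F t \<in> carrier_vec n" if "t \<in> T" for t using E_carrier F that by blast
    have diag: "vsum n G T \<bullet>c vsum n F T = (\<Sum>t\<in>T. G t \<bullet>c F t)" if G: "\<And>t. t \<in> T \<Longrightarrow> G t \<in> E t" for G
    proof -
      have "vsum n G T \<bullet>c vsum n F T = (\<Sum>s\<in>T. G s \<bullet>c vsum n F T)"
        using G E_carrier by (intro cip_vsum_left) auto
      also have "\<dots> = (\<Sum>s\<in>T. \<Sum>t\<in>T. G s \<bullet>c F t)"
        using G E_carrier Fc by (intro sum.cong cip_vsum_right) auto
      also have "\<dots> = (\<Sum>s\<in>T. \<Sum>t\<in>T. if s = t then G s \<bullet>c F s else 0)"
        using G F orth by (intro sum.cong) auto
      also have "\<dots> = (\<Sum>t\<in>T. G t \<bullet>c F t)"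
        using T by (intro sum.cong) simp_all
      finally show ?thesis .
    qed
    have "M x = vsum n (\<lambda>t. M (F t)) T"
    proof -
      have "B *\<^sub>v vsum n F T = vsum n (\<lambda>t. B *\<^sub>v F t) T"
        using AB Fc by (intro mat_vec_vsum)
      moreover have "A *\<^sub>v vsum n (\<lambda>t. B *\<^sub>v F t) T = vsum n (\<lambda>t. A *\<^sub>v (B *\<^sub>v F t)) T"
        using AB Fc by (intro mat_vec_vsum) (auto intro: carrier_vecI)
      ultimately show ?thesis by (simp add: M_def xF)
    qed
    then have "M x \<bullet>c x = (\<Sum>t\<in>T. M (F t) \<bullet>c F t)"
      using diag[of "\<lambda>t. M (F t)"] E_M F by (simp add: xF)
    moreover have "Re (x \<bullet>c x) = (\<Sum>t\<in>T. Re (F t \<bullet>c F t))"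
      using diag[of F] F by (simp add: xF)
    moreover have "scaled_in ?K (Re (F t \<bullet>c F t)) (M (F t) \<bullet>c F t)" if t: "t \<in> T" for t
    proof (cases "F t = 0\<^sub>v n")
      case True
      have "M (F t) \<bullet>c F t = 0" using True M_closed[of "F t"] by simp
      then show ?thesis using True by (simp add: scaled_in_def)
    next
      case False
      obtain r where r: "t = complex_of_real r" "0 \<le> r" "r \<le> 1"
        using E_range[OF F[OF t] False] by blast
      have Fr: "F t \<in> E (complex_of_real r)" using F[OF t] r(1) by simp
      show ?thesis
      proof (cases "r = 0 \<or> r = 1")
        case True
        show ?thesis
          by (rule value_at_endpoint[OF Fr True K]) (auto simp: S intro!: hull_inc)
      next
        case c: False
        then have r': "0 < r" "r < 1" using r by auto
        obtain l where l: "l \<in> spectrum (A * B)" "l \<notin> {a1 * b1, a1 * b2, a2 * b1, a2 * b2}"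
          "l + (a1 * a2 * b1 * b2) / l = block_trace a1 a2 b1 b2 r"
          using block_eigenvalue[OF Fr False r' ker] by blast
        have "ell_disk a1 a2 b1 b2 (block_trace a1 a2 b1 b2 r) \<subseteq> ?U"
          using l(1,2) unfolding l(3)[symmetric] S by blast
        also have "?U \<subseteq> ?K" using hull_subset[of "?U \<union> S" convex] by blast
        finally show ?thesis by (rule block_value_in_disk[OF Fr r' K])
      qed
    qed
    ultimately have "scaled_in ?K (Re (x \<bullet>c x)) (M x \<bullet>c x)"
      using scaled_in_sum[OF K T] by simp
    then show "w \<in> ?K" using x(2) w by (simp add: scaled_in_def)
  qed
qed

end

text \<open>The projection onto the eigenspace of \<open>a1\<close> is the polynomial \<open>(X - a2) / (a1 - a2)\<close> in \<open>X\<close>.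
With a single eigenvalue the spectral decomposition would make \<open>X\<close> scalar.\<close>
lemma normal_two_valued:
  assumes X: "X \<in> carrier_mat n n" and "normal_mat X" and "\<not> scalar_mat X"
    and spec: "spectrum X = {a1, a2}"
  obtains P where "a1 \<noteq> a2" "P \<in> carrier_mat n n"
    "\<And>x. x \<in> carrier_vec n \<Longrightarrow> X *\<^sub>v x = a2 \<cdot>\<^sub>v x + (a1 - a2) \<cdot>\<^sub>v (P *\<^sub>v x)"
    "\<And>x. x \<in> carrier_vec n \<Longrightarrow> P *\<^sub>v (P *\<^sub>v x) = P *\<^sub>v x"
    "\<And>x y. x \<in> carrier_vec n \<Longrightarrow> y \<in> carrier_vec n \<Longrightarrow> (P *\<^sub>v x) \<bullet>c y = x \<bullet>c (P *\<^sub>v y)"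
proof -
  have dX: "dim_row X = n" "dim_col X = n" using X by auto
  have X': "mat_adjoint X \<in> carrier_mat n n" using dX by (intro carrier_matI) simp_all
  interpret normal_pair n X "mat_adjoint X"
  proof
    show "X *\<^sub>v (mat_adjoint X *\<^sub>v x) = mat_adjoint X *\<^sub>v (X *\<^sub>v x)" if "x \<in> carrier_vec n" for x
      using \<open>normal_mat X\<close> assoc_mult_mat_vec[OF X X' that] assoc_mult_mat_vec[OF X' X that]
      unfolding normal_mat_def by simp
  qed (use X X' cip_adjoint[OF X] in auto)
  have ne: "a1 \<noteq> a2"
  proof
    assume eq: "a1 = a2"
    have Xx: "X *\<^sub>v x = a1 \<cdot>\<^sub>v x" if x: "x \<in> carrier_vec n" for x
    proof -
      obtain F where F: "F a1 \<in> carrier_vec n" "X *\<^sub>v F a1 = a1 \<cdot>\<^sub>v F a1" "x = vsum n F {a1}"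
        using spectral_decomposition[OF x] unfolding eigensum_def spec eq by auto
      have "x = F a1" unfolding F(3) using F(1) by (intro eq_vecI) auto
      then show ?thesis using F by simp
    qed
    have "X = a1 \<cdot>\<^sub>m 1\<^sub>m n"
    proof (rule eq_matI)
      fix i j assume "i < dim_row (a1 \<cdot>\<^sub>m 1\<^sub>m n)" "j < dim_col (a1 \<cdot>\<^sub>m 1\<^sub>m n)"
      then have ij: "i < n" "j < n" by simp_all
      have "X $$ (i, j) = (X *\<^sub>v unit_vec n j) $ i"
        using ij dX by (simp add: index_mult_mat_vec)
      also have "\<dots> = (a1 \<cdot>\<^sub>m 1\<^sub>m n) $$ (i, j)"
        using ij by (simp add: Xx)
      finally show "X $$ (i, j) = (a1 \<cdot>\<^sub>m 1\<^sub>m n) $$ (i, j)" .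
    qed (use dX in simp_all)
    then show False using \<open>\<not> scalar_mat X\<close> dX unfolding scalar_mat_def by metis
  qed
  define P where "P = (1 / (a1 - a2)) \<cdot>\<^sub>m (X - a2 \<cdot>\<^sub>m 1\<^sub>m n)"
  have P: "P \<in> carrier_mat n n" unfolding P_def by (intro carrier_matI) simp_all
  have P_index: "(P *\<^sub>v x) $ i = (1 / (a1 - a2)) * ((X *\<^sub>v x) $ i - a2 * x $ i)"
    if "i < n" "dim_vec x = n" for x i
  proof -
    have "(P *\<^sub>v x) $ i = (\<Sum>j<n. 1 / (a1 - a2) * (X $$ (i, j) * x $ j - (if i = j then a2 * x $ j else 0)))"
    proof -
      have "(P *\<^sub>v x) $ i = (\<Sum>j<n. P $$ (i, j) * x $ j)"
        using that P by (simp add: mat_vec_index)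
      also have "\<dots> = (\<Sum>j<n. 1 / (a1 - a2) * (X $$ (i, j) * x $ j - (if i = j then a2 * x $ j else 0)))"
        using that by (intro sum.cong) (auto simp: P_def algebra_simps)
      finally show ?thesis .
    qed
    also have "\<dots> = (1 / (a1 - a2)) * ((X *\<^sub>v x) $ i - a2 * x $ i)"
      using that by (simp add: mat_vec_index sum_subtractf flip: sum_divide_distrib)
    finally show ?thesis .
  qed
  have split: "\<exists>u v. u \<in> carrier_vec n \<and> v \<in> carrier_vec n \<and> x = u + v
      \<and> X *\<^sub>v u = a1 \<cdot>\<^sub>v u \<and> X *\<^sub>v v = a2 \<cdot>\<^sub>v v" if x: "x \<in> carrier_vec n" for x
  proof -
    obtain F where F: "F a1 \<in> carrier_vec n" "X *\<^sub>v F a1 = a1 \<cdot>\<^sub>v F a1"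
      "F a2 \<in> carrier_vec n" "X *\<^sub>v F a2 = a2 \<cdot>\<^sub>v F a2" "x = vsum n F {a1, a2}"
      using spectral_decomposition[OF x] unfolding eigensum_def spec by auto
    have "x = F a1 + F a2" unfolding F(5) using F(1,3) ne by (intro eq_vecI) auto
    then show ?thesis using F by blast
  qed
  have P_range: "P *\<^sub>v u = u" if "u \<in> carrier_vec n" "X *\<^sub>v u = a1 \<cdot>\<^sub>v u" for u
    using that P ne by (intro eq_vecI) (auto simp: P_index field_simps)
  have P_kernel: "P *\<^sub>v v = 0\<^sub>v n" if "v \<in> carrier_vec n" "X *\<^sub>v v = a2 \<cdot>\<^sub>v v" for v
    using that P by (intro eq_vecI) (auto simp: P_index)
  have Psum: "P *\<^sub>v (u + v) = u" if "u \<in> carrier_vec n" "v \<in> carrier_vec n"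
    "X *\<^sub>v u = a1 \<cdot>\<^sub>v u" "X *\<^sub>v v = a2 \<cdot>\<^sub>v v" for u v
    using that P P_range P_kernel by simp
  show ?thesis
  proof (rule that[OF ne P])
    show "X *\<^sub>v x = a2 \<cdot>\<^sub>v x + (a1 - a2) \<cdot>\<^sub>v (P *\<^sub>v x)" if "x \<in> carrier_vec n" for x
      using that ne P by (intro eq_vecI) (auto simp: P_index)
    show "P *\<^sub>v (P *\<^sub>v x) = P *\<^sub>v x" if x: "x \<in> carrier_vec n" for x
      using split[OF x] Psum P_range by metis
    show "(P *\<^sub>v x) \<bullet>c y = x \<bullet>c (P *\<^sub>v y)" if "x \<in> carrier_vec n" "y \<in> carrier_vec n" for x y
    proof -
      obtain u v where u: "u \<in> carrier_vec n" "v \<in> carrier_vec n" "x = u + v" "X *\<^sub>v u = a1 \<cdot>\<^sub>v u" "X *\<^sub>v v = a2 \<cdot>\<^sub>v v"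
        using split[OF \<open>x \<in> carrier_vec n\<close>] by blast
      obtain u' v' where u': "u' \<in> carrier_vec n" "v' \<in> carrier_vec n" "y = u' + v'" "X *\<^sub>v u' = a1 \<cdot>\<^sub>v u'" "X *\<^sub>v v' = a2 \<cdot>\<^sub>v v'"
        using split[OF \<open>y \<in> carrier_vec n\<close>] by blast
      have "u \<bullet>c v' = 0" "v \<bullet>c u' = 0"
        using eigen_orthogonal u u' ne by (metis, metis)
      then show ?thesis
        using u(1,2) u'(1,2) Psum[OF u(1,2,4,5)] Psum[OF u'(1,2,4,5)]
        by (simp add: u(3) u'(3) del: mat_vec_add)
    qed
  qed
qed

theorem theorem3p3:
  fixes n :: nat and A B :: "complex mat" and a1 a2 b1 b2 :: complex and S :: "complex set"
  assumes "A \<in> carrier_mat n n" and "B \<in> carrier_mat n n"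
    and "normal_mat A" and "normal_mat B"
    and "\<not> scalar_mat A" and "\<not> scalar_mat B"
    and "spectrum A = {a1, a2}" and "spectrum B = {b1, b2}"
    and "S = spectrum (A * B) \<inter> {a1 * b1, a1 * b2, a2 * b1, a2 * b2}"
    and "mat_kernel (A * B * (A * B)) = mat_kernel (A * B)"
  shows "numerical_range (A * B) =
    convex hull
      ((\<Union>l \<in> spectrum (A * B) - S. ell_disk a1 a2 b1 b2 (l + (a1 * a2 * b1 * b2) / l)) \<union> S)"
proof -
  obtain P where P: "a1 \<noteq> a2" "P \<in> carrier_mat n n"
    "\<And>x. x \<in> carrier_vec n \<Longrightarrow> A *\<^sub>v x = a2 \<cdot>\<^sub>v x + (a1 - a2) \<cdot>\<^sub>v (P *\<^sub>v x)"
    "\<And>x. x \<in> carrier_vec n \<Longrightarrow> P *\<^sub>v (P *\<^sub>v x) = P *\<^sub>v x"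
    "\<And>x y. x \<in> carrier_vec n \<Longrightarrow> y \<in> carrier_vec n \<Longrightarrow> (P *\<^sub>v x) \<bullet>c y = x \<bullet>c (P *\<^sub>v y)"
    using normal_two_valued[OF assms(1,3,5,7)] by blast
  obtain Q where Q: "b1 \<noteq> b2" "Q \<in> carrier_mat n n"
    "\<And>x. x \<in> carrier_vec n \<Longrightarrow> B *\<^sub>v x = b2 \<cdot>\<^sub>v x + (b1 - b2) \<cdot>\<^sub>v (Q *\<^sub>v x)"
    "\<And>x. x \<in> carrier_vec n \<Longrightarrow> Q *\<^sub>v (Q *\<^sub>v x) = Q *\<^sub>v x"
    "\<And>x y. x \<in> carrier_vec n \<Longrightarrow> y \<in> carrier_vec n \<Longrightarrow> (Q *\<^sub>v x) \<bullet>c y = x \<bullet>c (Q *\<^sub>v y)"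
    using normal_two_valued[OF assms(2,4,6,8)] by blast
  interpret two_valued_pair n P Q A B a1 a2 b1 b2
    by unfold_locales (use assms(1,2) P Q in auto)
  show ?thesis
  proof (rule numerical_range_eq[OF assms(9)])
    assume "0 \<in> spectrum (A * B)"
    then obtain x where x: "x \<in> carrier_vec n" "x \<noteq> 0\<^sub>v n" "(A * B) *\<^sub>v x = 0 \<cdot>\<^sub>v x"
      unfolding spectrum_def eigenvalue_def eigenvector_def by auto
    have zero: "0 \<cdot>\<^sub>v v = 0\<^sub>v n" if "v \<in> carrier_vec n" for v :: "complex Matrix.vec"
      using that by (intro eq_vecI) auto
    have 0: "A *\<^sub>v (B *\<^sub>v x) = 0\<^sub>v n"
      using x M_eq[OF x(1)] zero by (simp add: M_def)
    have Bx: "B *\<^sub>v x \<in> carrier_vec n" by (auto intro: carrier_vecI)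
    have "0 \<in> spectrum A \<or> 0 \<in> spectrum B"
    proof (cases "B *\<^sub>v x = 0\<^sub>v n")
      case True
      then have "eigenvector B x 0" using x zero by (simp add: eigenvector_def)
      then show ?thesis by (auto simp: spectrum_def eigenvalue_def)
    next
      case False
      then have "eigenvector A (B *\<^sub>v x) 0" using 0 Bx zero[OF Bx] by (simp add: eigenvector_def)
      then show ?thesis by (auto simp: spectrum_def eigenvalue_def)
    qed
    then show "a1 * a2 * b1 * b2 = 0" unfolding assms(7,8) by auto
  next
    fix v assume v: "v \<in> carrier_vec n" "M (M v) = 0\<^sub>v n"
    have AB': "A * B \<in> carrier_mat n n" using assms(1,2) by simp
    have "A * B * (A * B) *\<^sub>v v = M (M v)"
      using assoc_mult_mat_vec[OF AB' AB' v(1)] M_eq v(1) by simp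
    then have "v \<in> mat_kernel (A * B * (A * B))"
      using v by (simp add: mat_kernel_def)
    then have "v \<in> mat_kernel (A * B)" unfolding assms(10) .
    then show "M v = 0\<^sub>v n" using M_eq[OF v(1)] by (simp add: mat_kernel_def)
  qed
qed

end
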